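(* Let $q=p^{e}$ with $p$ an odd prime and $e\ge 1$, and let $l$ be an integer with $0\leq l\leq e-1$ and $2l\mid e$. Let $m$ be a positive integer with $m\mid (q-1)$. Set $y:=\frac{q-1}{p^{l}-1}$ and $m_{1}=\frac{m}{\gcd(m,y)}$. Let $n=rm$, where $r$ is an integer with $1\leq r\leq \frac{p^{l}-1}{m_{1}}$. Then for any integer $k$ with $1\leq k\leq \left\lfloor\frac{p^{l}+n}{p^{l}+1}\right\rfloor$: (1) there exists an $[[n,k-h,n-k+1;n-k-h]]_{q}$ MDS EAQECC for any integer $0\leq h\leq k-1$; (2) there exists an $[[n+1,k-h,n-k+2;n-k-h+1]]_{q}$ MDS EAQECC for any integer $0\leq h\leq k$; (3) there exists an $[[n+2,k-h,n-k+3;n-k-h+2]]_{q}$ MDS EAQECC for any integer $0\leq h\leq k-1$.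
   Context: An $[[N,K,d;c]]_q$ entanglement-assisted quantum error-correcting code (EAQECC) encodes $K$ logical qudits (of dimension $q$) into $N$ channel qudits using $c$ maximally entangled pairs shared in advance by sender and receiver, with minimum distance $d$. Formally: the sender holds $K$ information qudits, $N-K-c$ ancilla qudits in state $|0\rangle$, and her halves of $c$ maximally entangled pairs $q^{-1/2}\sum_{a\in\mathbb{F}_q}|a\rangle|a\rangle$ (the other halves being held by the receiver), and applies a unitary to her $N$ qudits; the code $Q$ is the resulting $q^K$-dimensional subspace of $(\mathbb{C}^q)^{\otimes N}\otimes(\mathbb{C}^q)^{\otimes c}$. Errors act only on the $N$ channel qudits (identity on the receiver's $c$ qudits) and have the form $\mathbf{e}=\gamma^{i}T(\mathbf{a})R(\mathbf{b})$ with $\mathbf{a},\mathbf{b}\in\mathbb{F}_q^N$, where $\gamma$ is a complex primitive $p$-th root of unity, $T(\mathbf{a})|\mathbf{v}\rangle=|\mathbf{v}+\mathbf{a}\rangle$ and $R(\mathbf{b})|\mathbf{v}\rangle=\gamma^{\mathrm{tr}_{\mathbb{F}_q/\mathbb{F}_p}(\sum_i b_iv_i)}|\mathbf{v}\rangle$; the weight of $\mathbf{e}$ is $\#\{i:(a_i,b_i)\neq(0,0)\}$. The code has minimum distance $d$ if $d$ is the largest integer such that $\langle \mathbf{u}|\mathbf{e}|\mathbf{v}\rangle=0$ for all $|\mathbf{u}\rangle,|\mathbf{v}\rangle\in Q$ with $\langle\mathbf{u}|\mathbf{v}\rangle=0$ and all errors $\mathbf{e}$ of weight at most $d-1$ (for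 $K=0$, by the usual convention, the condition is instead that $\langle\mathbf{u}|\mathbf{e}|\mathbf{u}\rangle=0$ for the code state and all errors of weight between $1$ and $d-1$). An $[[N,K,d;c]]_q$ EAQECC is called MDS if $N+c-K=2(d-1)$. *)

theory Defs
  imports Complex_Main "HOL-Computational_Algebra.Primes" "HOL-Library.Cardinality"
begin

section \<open>The trace to the prime field\<close>

definition prime_field_degree :: "'a::finite_field itself \<Rightarrow> nat" where
  "prime_field_degree _ = (THE e. CARD('a) = CHAR('a) ^ e)"

definition field_trace :: "'a::finite_field \<Rightarrow> 'a" where
  "field_trace x = (\<Sum>i<prime_field_degree TYPE('a). x ^ (CHAR('a) ^ i))"

text \<open>
  Elements of the prime field (such as traces) are used as exponents of a root of unity of
  order \<open>CHAR('a)\<close> through their representative in \<open>{0..<CHAR('a)}\<close>.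
\<close>

definition prime_field_rep :: "'a::finite_field \<Rightarrow> nat" where
  "prime_field_rep x = (LEAST t. of_nat t = x)"

definition primitive_root_of_unity :: "nat \<Rightarrow> complex \<Rightarrow> bool" where
  "primitive_root_of_unity m \<gamma> \<longleftrightarrow> 0 < m \<and> \<gamma> ^ m = 1 \<and> (\<forall>j. 0 < j \<and> j < m \<longrightarrow> \<gamma> ^ j \<noteq> 1)"


section \<open>States and operators\<close>

definition words :: "nat \<Rightarrow> 'a list set" where
  "words N = {v. length v = N}"

text \<open>
  A state of \<open>N\<close> channel qudits and \<open>c\<close> receiver qudits is given by its amplitudes: the function
  \<open>\<psi>\<close> stands for the sum of \<open>\<psi> (v, w) |v\<rangle>|w\<rangle>\<close> over \<open>v \<in> words N\<close>, \<open>w \<in> words c\<close>.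
  An operator on \<open>N\<close> qudits is given by its matrix entries \<open>M x y = \<langle>x|M|y\<rangle>\<close>
  for \<open>x, y \<in> words N\<close>.  Values at other arguments carry no information.
\<close>

type_synonym 'a state = "'a list \<times> 'a list \<Rightarrow> complex"
type_synonym 'a operator = "'a list \<Rightarrow> 'a list \<Rightarrow> complex"

definition state_inner :: "nat \<Rightarrow> nat \<Rightarrow> 'a::finite state \<Rightarrow> 'a state \<Rightarrow> complex" where
  "state_inner N c u v = (\<Sum>x\<in>words N. \<Sum>w\<in>words c. cnj (u (x, w)) * v (x, w))"

definition op_mult :: "nat \<Rightarrow> 'a::finite operator \<Rightarrow> 'a operator \<Rightarrow> 'a operator" where
  "op_mult N A B = (\<lambda>x y. \<Sum>z\<in>words N. A x z * B z y)"

definition op_adjoint :: "'a operator \<Rightarrow> 'a operator" where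
  "op_adjoint A = (\<lambda>x y. cnj (A y x))"

definition unitary_op :: "nat \<Rightarrow> 'a::finite operator \<Rightarrow> bool" where
  "unitary_op N U \<longleftrightarrow> (\<forall>x\<in>words N. \<forall>y\<in>words N.
     op_mult N (op_adjoint U) U x y = (if x = y then 1 else 0) \<and>
     op_mult N U (op_adjoint U) x y = (if x = y then 1 else 0))"

text \<open>The operator \<open>M \<otimes> I\<close>, with the identity on the \<open>c\<close> receiver qudits.\<close>

definition apply_channel :: "nat \<Rightarrow> nat \<Rightarrow> 'a::finite operator \<Rightarrow> 'a state \<Rightarrow> 'a state" where
  "apply_channel N c M \<psi> = (\<lambda>(x, w).
     if x \<in> words N \<and> w \<in> words c then \<Sum>y\<in>words N. M x y * \<psi> (y, w) else 0)"


section \<open>Errors\<close>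

definition shift_op :: "'a::finite_field list \<Rightarrow> 'a operator" where
  "shift_op a = (\<lambda>x y. if x = map2 (+) y a then 1 else 0)"

definition phase_op :: "complex \<Rightarrow> 'a::finite_field list \<Rightarrow> 'a operator" where
  "phase_op \<gamma> b = (\<lambda>x y. if x = y
     then \<gamma> ^ prime_field_rep (field_trace (sum_list (map2 (*) b y))) else 0)"

definition error_op ::
  "complex \<Rightarrow> nat \<Rightarrow> nat \<Rightarrow> 'a::finite_field list \<Rightarrow> 'a list \<Rightarrow> 'a operator" where
  "error_op \<gamma> N i a b = (\<lambda>x y. \<gamma> ^ i * op_mult N (shift_op a) (phase_op \<gamma> b) x y)"

definition error_weight :: "nat \<Rightarrow> 'a::zero list \<Rightarrow> 'a list \<Rightarrow> nat" where
  "error_weight N a b = card {i. i < N \<and> (a ! i, b ! i) \<noteq> (0, 0)}"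


section \<open>Entanglement-assisted codes\<close>

text \<open>The amplitude of \<open>|z\<rangle>|w\<rangle>\<close> in the tensor product of \<open>c\<close> maximally entangled pairs.\<close>

definition entangled_pairs :: "nat \<Rightarrow> 'a::finite list \<Rightarrow> 'a list \<Rightarrow> complex" where
  "entangled_pairs c z w =
     (\<Prod>i<c. if z ! i = w ! i then 1 / complex_of_real (sqrt (real CARD('a))) else 0)"

text \<open>
  The sender's qudits are ordered as \<open>K\<close> information qudits in the state \<open>\<phi>\<close>, then \<open>N - K - c\<close>
  ancillas in the state \<open>|0\<rangle>\<close>, then her halves of the \<open>c\<close> entangled pairs.
\<close>

definition input_state ::
  "nat \<Rightarrow> nat \<Rightarrow> nat \<Rightarrow> ('a list \<Rightarrow> complex) \<Rightarrow> 'a::{zero,finite} state" where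
  "input_state N K c \<phi> = (\<lambda>(x, w).
     \<phi> (take K x) *
     (if take (N - K - c) (drop K x) = replicate (N - K - c) 0 then 1 else 0) *
     entangled_pairs c (drop (N - c) x) w)"

definition ea_code :: "nat \<Rightarrow> nat \<Rightarrow> nat \<Rightarrow> 'a::finite_field state set \<Rightarrow> bool" where
  "ea_code N K c Q \<longleftrightarrow> K + c \<le> N \<and>
     (\<exists>U. unitary_op N U \<and> Q = range (\<lambda>\<phi>. apply_channel N c U (input_state N K c \<phi>)))"

definition distance_condition ::
  "complex \<Rightarrow> nat \<Rightarrow> nat \<Rightarrow> nat \<Rightarrow> 'a::finite_field state set \<Rightarrow> nat \<Rightarrow> bool" where
  "distance_condition \<gamma> N K c Q d \<longleftrightarrow>
     (if K = 0 then
        \<forall>u\<in>Q. \<forall>i. \<forall>a\<in>words N. \<forall>b\<in>words N.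
          1 \<le> error_weight N a b \<and> error_weight N a b < d \<longrightarrow>
          state_inner N c u (apply_channel N c (error_op \<gamma> N i a b) u) = 0
      else
        \<forall>u\<in>Q. \<forall>v\<in>Q. state_inner N c u v = 0 \<longrightarrow>
          (\<forall>i. \<forall>a\<in>words N. \<forall>b\<in>words N. error_weight N a b < d \<longrightarrow>
             state_inner N c u (apply_channel N c (error_op \<gamma> N i a b) v) = 0))"

definition min_distance ::
  "complex \<Rightarrow> nat \<Rightarrow> nat \<Rightarrow> nat \<Rightarrow> 'a::finite_field state set \<Rightarrow> nat \<Rightarrow> bool" where
  "min_distance \<gamma> N K c Q d \<longleftrightarrow> distance_condition \<gamma> N K c Q d \<and>
     (\<forall>d'. distance_condition \<gamma> N K c Q d' \<longrightarrow> d' \<le> d)"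

text \<open>\<open>eaqecc \<gamma> N K d c Q\<close>: \<open>Q\<close> is an \<open>[[N, K, d; c]]\<close> code over the field \<open>'a\<close>.\<close>

definition eaqecc ::
  "complex \<Rightarrow> nat \<Rightarrow> nat \<Rightarrow> nat \<Rightarrow> nat \<Rightarrow> 'a::finite_field state set \<Rightarrow> bool" where
  "eaqecc \<gamma> N K d c Q \<longleftrightarrow> ea_code N K c Q \<and> min_distance \<gamma> N K c Q d"

definition mds_eaqecc ::
  "complex \<Rightarrow> nat \<Rightarrow> nat \<Rightarrow> nat \<Rightarrow> nat \<Rightarrow> 'a::finite_field state set \<Rightarrow> bool" where
  "mds_eaqecc \<gamma> N K d c Q \<longleftrightarrow>
     eaqecc \<gamma> N K d c Q \<and> int N + int c - int K = 2 * (int d - 1)"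

end

theory Submission
  imports Defs "HOL-Computational_Algebra.Polynomial" "HOL-Number_Theory.Cong"
begin

text \<open>
  A CSS construction reduces the theorem to classical coding theory over the field with \<open>q\<close>
  elements: if \<open>C\<close> and \<open>C'\<close> are MDS codes of length \<open>N\<close> and dimension \<open>k\<close> and the intersection
  of \<open>C\<close> with the dual \<open>D\<close> of \<open>C'\<close> has dimension \<open>h\<close>, then there is an
  \<open>[[N, k - h, N - k + 1; N - k - h]]\<close> code. Shift errors outside \<open>C\<close> and phase errors outside
  \<open>C'\<close> map the code to an orthogonal space, and a word of minimum weight in \<open>C\<close> outside the
  intersection is an undetected error.

  Since the two codes need not be conjugate to each other, suitable pairs are easy to write down.
  Let \<open>D\<close> be the Reed-Solomon code of all polynomials of degree less than \<open>N - k\<close>, and let \<open>C\<close>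
  consist of the evaluations of \<open>P f\<close> with \<open>deg f < k\<close>, where \<open>P\<close> has degree \<open>N - k - h\<close> and no
  roots at the evaluation points. All degrees stay below \<open>N\<close>, so the intersection consists
  of the \<open>P f\<close> with \<open>deg f < h\<close>. The hypotheses on \<open>m\<close> and \<open>r\<close> give \<open>n \<le> q - 1\<close>, which
  leaves room for such a \<open>P\<close>; for length \<open>n + 2\<close>, which may be \<open>q + 1\<close>, the point at infinity
  is needed.
\<close>

section \<open>Additive characters of a finite field\<close>

definition additive_char :: "complex \<Rightarrow> 'a::finite_field \<Rightarrow> complex" where
  "additive_char \<gamma> x = \<gamma> ^ prime_field_rep (field_trace x)"

text \<open>Translation by \<open>1\<close> permutes the field, so \<open>x + 1\<close> and
  \<open>x\<close> have the same sum, and the number of elements is zero in the field.\<close>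

lemma CHAR_eq_if_CARD_prime_power:
  assumes "prime p" and "CARD('a::finite_field) = p ^ e"
  shows "CHAR('a) = p"
proof -
  have "(\<Sum>x\<in>(UNIV :: 'a set). x + 1) = (\<Sum>x\<in>UNIV. x)"
    by (rule sum.reindex_bij_witness[of _ "\<lambda>x. x - 1" "\<lambda>x. x + 1"]) auto
  then have "of_nat (p ^ e) = (0 :: 'a)"
    by (simp add: sum.distrib assms(2))
  then have "CHAR('a) dvd p ^ e"
    using of_nat_eq_0_iff_char_dvd by blast
  then have "CHAR('a) dvd p"
    using CHAR_prime[where ?'a = 'a] prime_dvd_power by blast
  then show ?thesis
    using CHAR_prime[where ?'a = 'a] assms(1) by (simp add: primes_dvd_imp_eq)
qed

locale finite_field_character =
  fixes field_type :: "'a::finite_field itself" and p e :: nat and \<gamma> :: complex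
  assumes prime_p: "prime p" and e_pos: "e \<ge> 1" and card_field: "CARD('a) = p ^ e"
    and primitive: "primitive_root_of_unity p \<gamma>"
begin

lemma char_field: "CHAR('a) = p"
  using CHAR_eq_if_CARD_prime_power prime_p card_field by blast

lemma degree_field: "prime_field_degree TYPE('a) = e"
proof -
  have "p > 1"
    using prime_p prime_gt_1_nat by blast
  then show ?thesis
    unfolding prime_field_degree_def char_field card_field
    by (intro the_equality) (auto simp: power_inject_exp)
qed

lemma field_trace_alt: "field_trace (x :: 'a) = (\<Sum>i<e. x ^ (p ^ i))"
  by (simp add: field_trace_def degree_field char_field)

lemma field_trace_add: "field_trace (x + y :: 'a) = field_trace x + field_trace y"
proof -
  have "(x + y) ^ (p ^ i) = x ^ (p ^ i) + y ^ (p ^ i)" for i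
    by (rule freshmans_dream') (simp_all add: char_field prime_p)
  then show ?thesis
    by (simp add: field_trace_alt sum.distrib)
qed

text \<open>Frobenius shifts the summands of the trace cyclically, because
  \<open>x ^ (p ^ e)\<close> is \<open>x\<close> again. Hence traces lie in the prime field.\<close>

lemma field_trace_power: "field_trace (x :: 'a) ^ p = field_trace x"
proof -
  obtain e' where e': "e = Suc e'"
    using e_pos by (cases e) auto
  have "field_trace x ^ p = (\<Sum>i<e. (x ^ (p ^ i)) ^ p)"
    unfolding field_trace_alt by (rule freshmans_dream_sum) (simp_all add: char_field prime_p)
  also have "\<dots> = (\<Sum>i<e. x ^ (p ^ Suc i))"
    by (intro sum.cong refl) (simp only: power_mult[symmetric] power_Suc2)
  also have "\<dots> = (\<Sum>i<e'. x ^ (p ^ Suc i)) + x ^ (p ^ e)"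
    by (simp add: e')
  also have "x ^ (p ^ e) = x ^ (p ^ 0)"
    using finite_field_power_card_eq_same[of x] unfolding card_field by simp
  also have "(\<Sum>i<e'. x ^ (p ^ Suc i)) + x ^ (p ^ 0) = field_trace x"
    unfolding field_trace_alt e' sum.lessThan_Suc_shift by (simp add: add.commute)
  finally show ?thesis .
qed

text \<open>The \<open>p\<close> images of \<open>0, \<dots>, p - 1\<close> already exhaust the roots of \<open>X ^ p - X\<close>.\<close>

lemma prime_field_eqI:
  fixes x :: 'a
  assumes "x ^ p = x"
  obtains t where "t < p" and "x = of_nat t"
proof -
  define f where "f = monom 1 p - monom (1 :: 'a) 1"
  have p1: "p > 1"
    using prime_p prime_gt_1_nat by blast
  have deg: "degree f \<le> p"
    unfolding f_def using p1 by (intro degree_diff_le) (auto simp: degree_monom_eq)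
  have "coeff f p = 1"
    using p1 by (simp add: f_def)
  then have f0: "f \<noteq> 0"
    by auto
  have roots: "poly f z = z ^ p - z" for z
    by (simp add: f_def poly_monom)
  have inj: "inj_on (of_nat :: nat \<Rightarrow> 'a) {..<p}"
    by (auto simp only: of_nat_eq_iff_cong_CHAR char_field intro!: inj_onI
        dest: cong_less_modulus_unique_nat)
  have img: "of_nat ` {..<p} \<subseteq> {z. poly f z = 0}"
  proof safe
    fix t
    have "(of_nat t :: 'a) ^ p = of_nat t"
    proof (induction t)
      case (Suc t)
      have "(1 + of_nat t :: 'a) ^ p = 1 ^ p + of_nat t ^ p"
        by (rule freshmans_dream) (simp_all add: char_field prime_p)
      then show ?case
        using Suc by simp
    qed (use p1 in simp)
    then show "poly f (of_nat t) = 0"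
      by (simp add: roots)
  qed
  have "card {z. poly f z = 0} \<le> p"
    using card_poly_roots_bound[OF f0] deg by simp
  moreover have "card (of_nat ` {..<p} :: 'a set) = p"
    using card_image[OF inj] by simp
  ultimately have "of_nat ` {..<p} = {z. poly f z = 0}"
    by (intro card_seteq[OF poly_roots_finite[OF f0] img]) simp
  moreover have "x \<in> {z. poly f z = 0}"
    using assms by (simp add: roots)
  ultimately have "x \<in> of_nat ` {..<p}"
    by (simp only:)
  then show thesis
    using that by blast
qed

text \<open>The least representative is congruent to \<open>t\<close> modulo \<open>p\<close>, and
  \<open>\<gamma> ^ p = 1\<close>. Exponents may therefore be added without reduction.\<close>

lemma power_prime_field_rep: "\<gamma> ^ prime_field_rep (of_nat t :: 'a) = \<gamma> ^ t"
proof -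
  have "of_nat (prime_field_rep (of_nat t :: 'a)) = (of_nat t :: 'a)"
    unfolding prime_field_rep_def by (rule LeastI) (rule refl)
  then have "[prime_field_rep (of_nat t :: 'a) = t] (mod p)"
    by (simp only: of_nat_eq_iff_cong_CHAR char_field)
  then have eq: "prime_field_rep (of_nat t :: 'a) mod p = t mod p"
    by (simp add: cong_def)
  have red: "\<gamma> ^ s = \<gamma> ^ (s mod p)" for s
  proof -
    have "\<gamma> ^ s = \<gamma> ^ (p * (s div p) + s mod p)"
      by simp
    also have "\<dots> = \<gamma> ^ (s mod p)"
      using primitive unfolding power_add power_mult by (simp add: primitive_root_of_unity_def)
    finally show ?thesis .
  qed
  show ?thesis
    using red[of "prime_field_rep (of_nat t :: 'a)"] red[of t] eq by simp
qed

lemma additive_char_trace: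
  obtains t where "t < p" and "field_trace (x :: 'a) = of_nat t" and "additive_char \<gamma> x = \<gamma> ^ t"
  using prime_field_eqI[OF field_trace_power[of x]]
  by (auto simp: additive_char_def power_prime_field_rep)

lemma additive_char_add: "additive_char \<gamma> (x + y :: 'a) = additive_char \<gamma> x * additive_char \<gamma> y"
proof -
  obtain s where s: "field_trace x = of_nat s" "additive_char \<gamma> x = \<gamma> ^ s"
    using additive_char_trace by blast
  obtain t where t: "field_trace y = of_nat t" "additive_char \<gamma> y = \<gamma> ^ t"
    using additive_char_trace by blast
  have "field_trace (x + y) = of_nat (s + t)"
    by (simp add: field_trace_add s t)
  then have "additive_char \<gamma> (x + y) = \<gamma> ^ (s + t)"
    by (simp only: additive_char_def power_prime_field_rep)
  then show ?thesis
    using s t by (simp add: power_add)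
qed

lemma norm_root: "norm \<gamma> = 1"
proof -
  have "norm \<gamma> ^ p = 1 ^ p"
    using primitive by (metis norm_one norm_power power_one primitive_root_of_unity_def)
  then show ?thesis
    by (rule power_eq_imp_eq_base) (use prime_p prime_gt_0_nat in auto)
qed

lemma norm_additive_char: "norm (additive_char \<gamma> (x :: 'a)) = 1"
  by (simp add: additive_char_def norm_power norm_root)

lemma additive_char_0 [simp]: "additive_char \<gamma> (0 :: 'a) = 1"
proof -
  have "additive_char \<gamma> (0 :: 'a) \<noteq> 0"
    using norm_additive_char[of 0] by auto
  then show ?thesis
    using additive_char_add[of 0 0] by simp
qed

lemma cnj_additive_char: "cnj (additive_char \<gamma> (x :: 'a)) = additive_char \<gamma> (- x)"
proof -
  have "cnj (additive_char \<gamma> x) * additive_char \<gamma> x = 1"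
    using norm_additive_char[of x] by (simp add: mult.commute complex_norm_square[symmetric])
  moreover have "additive_char \<gamma> (- x) * additive_char \<gamma> x = 1"
    using additive_char_add[of "- x" x] by simp
  ultimately show ?thesis
    using norm_additive_char[of x] by (metis mult_right_cancel norm_zero zero_neq_one)
qed

text \<open>The trace is a nonzero polynomial of degree at most \<open>p ^ (e - 1)\<close>, too
  small to vanish on the whole field. Where it does not vanish, the exponent lies strictly between
  \<open>0\<close> and \<open>p\<close>, and primitivity applies.\<close>

lemma additive_char_nontrivial: "\<exists>x :: 'a. additive_char \<gamma> x \<noteq> 1"
proof -
  define f where "f = (\<Sum>i<e. monom (1 :: 'a) (p ^ i))"
  have p1: "p > 1"
    using prime_p prime_gt_1_nat by blast
  have deg: "degree f \<le> p ^ (e - 1)"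
    unfolding f_def
  proof (intro degree_sum_le)
    fix i assume "i \<in> {..<e}"
    then have "p ^ i \<le> p ^ (e - 1)"
      using p1 by (intro power_increasing) auto
    then show "degree (monom (1 :: 'a) (p ^ i)) \<le> p ^ (e - 1)"
      by (simp add: degree_monom_eq)
  qed simp
  have "coeff f 1 = (\<Sum>i<e. if i = 0 then 1 else 0)"
    unfolding f_def coeff_sum using p1 by (intro sum.cong) auto
  also have "\<dots> = 1"
    using e_pos by (simp add: sum.delta)
  finally have f0: "f \<noteq> 0"
    by auto
  have "p ^ (e - 1) < p ^ e"
    using p1 e_pos by (intro power_strict_increasing) auto
  then have "card {x. poly f x = 0} < CARD('a)"
    using card_poly_roots_bound[OF f0] deg by (simp add: card_field)
  then have "{x. poly f x = 0} \<noteq> UNIV"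
    by (intro notI) simp
  then obtain x where x: "poly f x \<noteq> 0"
    by auto
  have tr: "field_trace x \<noteq> 0"
    using x by (simp add: f_def poly_sum poly_monom field_trace_alt)
  obtain t where t: "t < p" "field_trace x = of_nat t" "additive_char \<gamma> x = \<gamma> ^ t"
    using additive_char_trace by blast
  then have "t \<noteq> 0"
    using tr by (cases t) auto
  then have "additive_char \<gamma> x \<noteq> 1"
    using t primitive by (auto simp: primitive_root_of_unity_def)
  then show ?thesis
    by blast
qed

end

section \<open>Words\<close>

abbreviation dot :: "'a::comm_semiring_0 list \<Rightarrow> 'a list \<Rightarrow> 'a" where
  "dot b y \<equiv> sum_list (map2 (*) b y)"

abbreviation vadd :: "'a::monoid_add list \<Rightarrow> 'a list \<Rightarrow> 'a list" where
  "vadd \<equiv> map2 (+)"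

abbreviation zeros :: "nat \<Rightarrow> 'a::zero list" where
  "zeros n \<equiv> replicate n 0"

abbreviation hamming_weight :: "nat \<Rightarrow> 'a::zero list \<Rightarrow> nat" where
  "hamming_weight n x \<equiv> card {r. r < n \<and> x ! r \<noteq> 0}"

lemma words_iff [simp]: "x \<in> words n \<longleftrightarrow> length x = n"
  by (simp add: words_def)

lemma finite_words [simp]: "finite (words n :: 'a::finite list set)"
  unfolding words_def using finite_lists_length_eq[of "UNIV :: 'a set" n] by simp

lemma card_words: "card (words n :: 'a::finite list set) = CARD('a) ^ n"
  unfolding words_def using card_lists_length_eq[of "UNIV :: 'a set" n] by simp

lemma vadd_zeros_left [simp]: "length x = n \<Longrightarrow> vadd (zeros n) (x :: 'a::monoid_add list) = x"
  by (intro nth_equalityI) auto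

lemma vadd_zeros_right [simp]: "length x = n \<Longrightarrow> vadd (x :: 'a::monoid_add list) (zeros n) = x"
  by (intro nth_equalityI) auto

lemma vadd_uminus_cancel [simp]:
  "length x = length y \<Longrightarrow> vadd (vadd x (map uminus y)) (y :: 'a::ab_group_add list) = x"
  by (intro nth_equalityI) auto

lemma vadd_uminus_cancel' [simp]:
  "length x = length y \<Longrightarrow> vadd (vadd x y) (map uminus y :: 'a::ab_group_add list) = x"
  by (intro nth_equalityI) auto

lemma vadd_eq_self_iff:
  "length x = n \<Longrightarrow> length a = n \<Longrightarrow> vadd x a = (x :: 'a::ab_group_add list) \<longleftrightarrow> a = zeros n"
  by (auto simp: list_eq_iff_nth_eq)

lemma vadd_uminus_eq_zeros_iff:
  "length x = n \<Longrightarrow> length y = n \<Longrightarrow>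
     vadd x (map uminus y) = zeros n \<longleftrightarrow> x = (y :: 'a::ab_group_add list)"
  by (auto simp: list_eq_iff_nth_eq)

lemma bij_betw_vadd:
  "(x0 :: 'a::ab_group_add list) \<in> words n \<Longrightarrow> bij_betw (\<lambda>x. vadd x x0) (words n) (words n)"
  by (rule bij_betw_byWitness[where f' = "\<lambda>x. vadd x (map uminus x0)"]) (auto simp del: map_map)

lemma dot_sum: "length b = n \<Longrightarrow> length y = n \<Longrightarrow> dot b y = (\<Sum>i<n. b ! i * y ! i)"
  by (simp add: sum_list_sum_nth atLeast0LessThan)

lemma dot_commute: "dot b y = dot y (b :: 'a::comm_semiring_0 list)"
  by (induction b y rule: list_induct2') (simp_all add: mult.commute)

lemma dot_vadd_right:
  assumes "length b = n" "length x = n" "length y = n"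
  shows "dot b (vadd x y) = dot b x + dot b (y :: 'a::comm_semiring_0 list)"
  using assms by (simp add: dot_sum[of _ n] distrib_left sum.distrib)

lemma dot_zeros_left [simp]: "length y = n \<Longrightarrow> dot (zeros n) (y :: 'a::comm_semiring_0 list) = 0"
  by (simp add: dot_sum[of _ n])

lemma dot_zeros_right [simp]: "length b = n \<Longrightarrow> dot (b :: 'a::comm_semiring_0 list) (zeros n) = 0"
  by (simp add: dot_sum[of _ n])

text \<open>The translation only permutes the summands, yet multiplies the sum by
  \<open>\<omega>\<close>. Both vanishing character sums below are instances.\<close>

lemma sum_eq_0_if_translate:
  fixes g :: "'b \<Rightarrow> complex"
  assumes "bij_betw \<tau> S S" and "\<And>s. s \<in> S \<Longrightarrow> g (\<tau> s) = \<omega> * g s" and "\<omega> \<noteq> 1"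
  shows "sum g S = 0"
proof -
  have "sum g S = (\<Sum>s\<in>S. g (\<tau> s))"
    using sum.reindex_bij_betw[OF assms(1)] by metis
  also have "\<dots> = \<omega> * sum g S"
    by (simp add: assms(2) sum_distrib_left)
  finally show ?thesis
    using assms(3) by simp
qed

section \<open>Character sums over words\<close>

context finite_field_character
begin

abbreviation "\<chi> \<equiv> additive_char \<gamma> :: 'a \<Rightarrow> complex"

lemma cnj_char_mult: "cnj (\<chi> x) * \<chi> y = \<chi> (y - x)"
  by (simp add: cnj_additive_char additive_char_add[symmetric])

lemma char_dot_orthogonality:
  assumes a: "a \<in> words n" and b: "b \<in> words n"
  shows "(\<Sum>u\<in>words n. cnj (\<chi> (dot u a)) * \<chi> (dot u b)) = (if a = b then of_nat (CARD('a) ^ n) else 0)"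
proof (cases "a = b")
  case True
  then show ?thesis
    by (simp add: cnj_char_mult card_words)
next
  case False
  then obtain r where r: "r < n" "a ! r \<noteq> b ! r"
    using a b by (metis words_iff nth_equalityI)
  obtain \<alpha> where \<alpha>: "\<chi> \<alpha> \<noteq> 1"
    using additive_char_nontrivial by blast
  \<comment> \<open>A multiple of the unit vector at a position where \<open>a\<close> and
    \<open>b\<close> differ, scaled so that its products with \<open>b\<close> and \<open>a\<close>
    differ by \<open>\<alpha>\<close>.\<close>
  define u0 where "u0 = (zeros n)[r := \<alpha> / (b ! r - a ! r)]"
  have u0: "u0 \<in> words n"
    by (simp add: u0_def words_def)
  have du0: "dot u0 x = \<alpha> / (b ! r - a ! r) * x ! r" if "x \<in> words n" for x
  proof -
    have "dot u0 x = (\<Sum>i<n. u0 ! i * x ! i)"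
      using that u0 by (intro dot_sum) simp_all
    also have "\<dots> = (\<Sum>i<n. if i = r then \<alpha> / (b ! r - a ! r) * x ! r else 0)"
      by (intro sum.cong refl) (simp add: u0_def nth_list_update)
    finally show ?thesis
      using r by simp
  qed
  have "dot u0 b - dot u0 a = \<alpha>"
    using r a b by (simp add: du0 diff_divide_distrib[symmetric] right_diff_distrib[symmetric])
  then have ne: "cnj (\<chi> (dot u0 a)) * \<chi> (dot u0 b) \<noteq> 1"
    using \<alpha> by (simp add: cnj_char_mult)
  have add: "dot (vadd u u0) x = dot u x + dot u0 x" if "u \<in> words n" "x \<in> words n" for u x
    using that u0 by (simp add: dot_sum[of _ n] distrib_right sum.distrib)
  have "(\<Sum>u\<in>words n. cnj (\<chi> (dot u a)) * \<chi> (dot u b)) = 0"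
    by (rule sum_eq_0_if_translate[OF bij_betw_vadd[OF u0] _ ne])
      (use a b in \<open>simp add: add additive_char_add\<close>)
  then show ?thesis
    using False by simp
qed

end

section \<open>Entanglement-assisted codes from a pair of classical codes\<close>

text \<open>
  \<open>enc\<close> is an invertible linear map whose four arguments are the coordinates with respect to
  a basis of the channel space adapted to two classical codes: \<open>enc i u 0 0\<close> runs through the
  first code, \<open>enc 0 u 0 z\<close> through the dual of the second one, and \<open>enc 0 u 0 0\<close> through their
  intersection. The logical basis state \<open>i\<close> is encoded, up to normalisation, as the sum of
  \<open>|enc i u 0 z\<rangle>|z\<rangle>\<close> over all \<open>u\<close> and \<open>z\<close>.
\<close>

locale css_encoder = finite_field_character field_type p e \<gamma>
  for field_type :: "'a::finite_field itself" and p e :: nat and \<gamma> :: complex +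
  fixes N K h c :: nat and enc :: "'a list \<Rightarrow> 'a list \<Rightarrow> 'a list \<Rightarrow> 'a list \<Rightarrow> 'a list"
  assumes N_eq: "N = K + (h + (h + c))"
    and enc_words: "\<lbrakk>i \<in> words K; u \<in> words h; t \<in> words h; z \<in> words c\<rbrakk> \<Longrightarrow> enc i u t z \<in> words N"
    and enc_add: "\<lbrakk>i \<in> words K; u \<in> words h; t \<in> words h; z \<in> words c;
        i' \<in> words K; u' \<in> words h; t' \<in> words h; z' \<in> words c\<rbrakk> \<Longrightarrow>
      enc (vadd i i') (vadd u u') (vadd t t') (vadd z z') = vadd (enc i u t z) (enc i' u' t' z')"
    and enc_kernel: "\<lbrakk>i \<in> words K; u \<in> words h; t \<in> words h; z \<in> words c;
        enc i u t z = zeros N\<rbrakk> \<Longrightarrow> i = zeros K \<and> u = zeros h \<and> t = zeros h \<and> z = zeros c"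
begin

section \<open>The unitary encoder and its amplitudes\<close>

lemma length_enc [simp]:
  "\<lbrakk>length i = K; length u = h; length t = h; length z = c\<rbrakk> \<Longrightarrow> length (enc i u t z) = N"
  using enc_words by simp

definition coords :: "('a list \<times> 'a list \<times> 'a list \<times> 'a list) set" where
  "coords = words K \<times> words h \<times> words h \<times> words c"

definition encode :: "'a list \<times> 'a list \<times> 'a list \<times> 'a list \<Rightarrow> 'a list" where
  "encode = (\<lambda>(i, u, t, z). enc i u t z)"

text \<open>The order matches the registers of \<open>input_state\<close>: \<open>i\<close> is the
  information, \<open>u\<close> and \<open>t\<close> together fill the
  \<open>N - K - c = h + h\<close> ancillas, and \<open>z\<close> is the sender's half of the
  pairs.\<close>

definition concat_blocks :: "'a list \<times> 'a list \<times> 'a list \<times> 'a list \<Rightarrow> 'a list" where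
  "concat_blocks = (\<lambda>(i, u, t, z). i @ u @ t @ z)"

definition blocks :: "'a list \<Rightarrow> 'a list \<times> 'a list \<times> 'a list \<times> 'a list" where
  "blocks y = (take K y, take h (drop K y), take h (drop h (drop K y)), drop h (drop h (drop K y)))"

definition fourier :: "'a list \<Rightarrow> 'a list \<Rightarrow> complex" where
  "fourier u v = \<chi> (dot u v) / complex_of_real (sqrt (real (CARD('a) ^ h)))"

text \<open>The Fourier transform on the second block turns its ancillas into uniform superpositions.\<close>

definition block_fourier ::
  "'a list \<times> 'a list \<times> 'a list \<times> 'a list \<Rightarrow> 'a list \<times> 'a list \<times> 'a list \<times> 'a list \<Rightarrow> complex" where
  "block_fourier = (\<lambda>(i, u, t, z) (i', u', t', z').
     if i = i' \<and> t = t' \<and> z = z' then fourier u u' else 0)"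

text \<open>Columns are read in register blocks, rows in the coordinates of \<open>encode\<close>:
  the block Fourier transform is followed by relabelling the basis state \<open>s\<close> as
  \<open>encode s\<close>.\<close>

definition encoder :: "'a operator" where
  "encoder x y = block_fourier (inv_into coords encode x) (blocks y)"

definition encoded :: "('a list \<Rightarrow> complex) \<Rightarrow> 'a state" where
  "encoded \<phi> = apply_channel N c encoder (input_state N K c \<phi>)"

text \<open>The first factor comes from the Fourier transform of \<open>h\<close> zero ancillas, the
  second from the \<open>c\<close> entangled pairs.\<close>

definition amplitude :: complex where
  "amplitude = (1 / complex_of_real (sqrt (real (CARD('a) ^ h)))) *
     (1 / complex_of_real (sqrt (real CARD('a)))) ^ c"

lemma amplitude_nonzero: "amplitude \<noteq> 0"
  by (simp add: amplitude_def)

lemma finite_coords [simp]: "finite coords"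
  by (simp add: coords_def)

lemma sum_coords:
  "sum f coords = (\<Sum>i\<in>words K. \<Sum>u\<in>words h. \<Sum>t\<in>words h. \<Sum>z\<in>words c. f (i, u, t, z))"
  unfolding coords_def by (simp add: sum.cartesian_product)

lemma card_coords: "card coords = CARD('a) ^ N"
  by (simp add: coords_def card_cartesian_product card_words N_eq power_add)

text \<open>The coordinatewise difference of two preimages of a word lies in the kernel, which gives
  injectivity; equal cardinalities give surjectivity.\<close>

lemma bij_encode: "bij_betw encode coords (words N)"
proof -
  have "inj_on encode coords"
  proof (rule inj_onI)
    fix x y assume xy: "x \<in> coords" "y \<in> coords" "encode x = encode y"
    obtain i u t z where x: "x = (i, u, t, z)"
      by (cases x)
    obtain i' u' t' z' where y: "y = (i', u', t', z')"
      by (cases y)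
    have mem: "i \<in> words K" "u \<in> words h" "t \<in> words h" "z \<in> words c"
      "i' \<in> words K" "u' \<in> words h" "t' \<in> words h" "z' \<in> words c"
      using xy by (auto simp: coords_def x y)
    define di where "di = vadd i (map uminus i')"
    define du where "du = vadd u (map uminus u')"
    define dt where "dt = vadd t (map uminus t')"
    define dz where "dz = vadd z (map uminus z')"
    have d: "di \<in> words K" "du \<in> words h" "dt \<in> words h" "dz \<in> words c"
      using mem by (simp_all add: di_def du_def dt_def dz_def)
    have "vadd (enc di du dt dz) (enc i' u' t' z') = enc i u t z"
      using enc_add[OF d mem(5-8)] mem by (simp add: di_def du_def dt_def dz_def)
    also have "\<dots> = enc i' u' t' z'"
      using xy by (simp add: encode_def x y)
    finally have eq: "vadd (enc di du dt dz) (enc i' u' t' z') = enc i' u' t' z'" .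
    have len: "length (enc di du dt dz) = N" "length (enc i' u' t' z') = N"
      using enc_words d mem by auto
    have "enc di du dt dz = zeros N"
      using eq len by (simp add: list_eq_iff_nth_eq)
    from enc_kernel[OF d this] show "x = y"
      using mem by (simp add: x y di_def du_def dt_def dz_def vadd_uminus_eq_zeros_iff)
  qed
  moreover have "encode ` coords \<subseteq> words N"
    using enc_words by (auto simp: encode_def coords_def)
  ultimately show ?thesis
    unfolding bij_betw_def
    by (metis card_coords card_image card_subset_eq card_words finite_words)
qed

lemma bij_concat: "bij_betw concat_blocks coords (words N)"
  by (rule bij_betw_byWitness[where f' = blocks])
    (auto simp: coords_def concat_blocks_def blocks_def N_eq simp del: drop_drop)

lemma blocks_concat: "s \<in> coords \<Longrightarrow> blocks (concat_blocks s) = s"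
  by (auto simp: coords_def concat_blocks_def blocks_def)

lemma blocks_in_coords: "y \<in> words N \<Longrightarrow> blocks y \<in> coords"
  by (auto simp: coords_def blocks_def N_eq)

lemma blocks_inj: "x \<in> words N \<Longrightarrow> y \<in> words N \<Longrightarrow> blocks x = blocks y \<longleftrightarrow> x = y"
  by (metis bij_betw_imp_surj_on bij_concat blocks_concat imageE)

lemma inv_encode [simp]: "s \<in> coords \<Longrightarrow> inv_into coords encode (encode s) = s"
  using bij_encode by (simp add: bij_betw_inv_into_left)

lemma sum_encode: "(\<Sum>x\<in>words N. f x) = (\<Sum>s\<in>coords. f (encode s))"
  using sum.reindex_bij_betw[OF bij_encode, of f] by simp

lemma sum_concat: "(\<Sum>x\<in>words N. f x) = (\<Sum>s\<in>coords. f (concat_blocks s))"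
  using sum.reindex_bij_betw[OF bij_concat, of f] by simp

lemma sum_coords_fibre:
  assumes "i \<in> words K" "t \<in> words h" "z \<in> words c"
    and "\<And>i' u' t' z'. (i', t', z') \<noteq> (i, t, z) \<Longrightarrow> F (i', u', t', z') = 0"
  shows "sum F coords = (\<Sum>u\<in>words h. F (i, u, t, z))"
proof -
  have "sum F coords = sum F ((\<lambda>u. (i, u, t, z)) ` words h)"
  proof (rule sum.mono_neutral_right)
    show "(\<lambda>u. (i, u, t, z)) ` words h \<subseteq> coords"
      using assms(1-3) by (auto simp: coords_def)
    show "\<forall>r\<in>coords - (\<lambda>u. (i, u, t, z)) ` words h. F r = 0"
    proof
      fix r assume r: "r \<in> coords - (\<lambda>u. (i, u, t, z)) ` words h"
      obtain i' u' t' z' where r': "r = (i', u', t', z')"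
        by (cases r)
      have "(i', t', z') \<noteq> (i, t, z)"
        using r unfolding r' coords_def by blast
      then show "F r = 0"
        unfolding r' by (rule assms(4))
    qed
  qed simp
  then show ?thesis
    by (simp add: sum.reindex inj_on_def)
qed

lemma block_fourier_commute: "block_fourier s s' = block_fourier s' s"
  by (auto simp: block_fourier_def fourier_def dot_commute split: prod.splits)

lemma block_fourier_orthogonality:
  assumes "s \<in> coords" "s' \<in> coords"
  shows "(\<Sum>r\<in>coords. cnj (block_fourier r s) * block_fourier r s') = (if s = s' then 1 else 0)"
proof -
  obtain i u t z where s: "s = (i, u, t, z)"
    by (cases s)
  obtain i' u' t' z' where s': "s' = (i', u', t', z')"
    by (cases s')
  have mem: "i \<in> words K" "u \<in> words h" "t \<in> words h" "z \<in> words c" "u' \<in> words h"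
    using assms by (auto simp: coords_def s s')
  define F where "F r = cnj (block_fourier r s) * block_fourier r s'" for r
  have "sum F coords = (\<Sum>v\<in>words h. F (i, v, t, z))"
    by (rule sum_coords_fibre[OF mem(1) mem(3) mem(4)])
      (auto simp: F_def block_fourier_def s)
  also have "\<dots> = (if (i, t, z) = (i', t', z')
      then (\<Sum>v\<in>words h. cnj (fourier v u) * fourier v u') else 0)"
    by (auto simp: F_def block_fourier_def s s')
  also have "(\<Sum>v\<in>words h. cnj (fourier v u) * fourier v u') =
      (\<Sum>v\<in>words h. cnj (\<chi> (dot v u)) * \<chi> (dot v u')) / of_nat (CARD('a) ^ h)"
    unfolding sum_divide_distrib
    by (intro sum.cong refl) (simp add: fourier_def flip: of_real_mult)
  also have "\<dots> = (if u = u' then 1 else 0)"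
    using char_dot_orthogonality mem by simp
  finally show ?thesis
    by (auto simp: F_def s s')
qed

text \<open>Both products reduce to \<open>block_fourier_orthogonality\<close>: orthonormality of
  columns directly, that of rows through the symmetry of \<open>block_fourier\<close>.\<close>

lemma unitary_encoder: "unitary_op N encoder"
proof -
  have "op_mult N (op_adjoint encoder) encoder x y = (if x = y then 1 else 0)"
    if "x \<in> words N" "y \<in> words N" for x y
    using block_fourier_orthogonality[OF blocks_in_coords blocks_in_coords, OF that] that
    by (simp add: op_mult_def op_adjoint_def encoder_def sum_encode blocks_inj cong: sum.cong)
  moreover have "op_mult N encoder (op_adjoint encoder) x y = (if x = y then 1 else 0)"
    if x: "x \<in> words N" and y: "y \<in> words N" for x y
  proof -
    obtain s where s: "s \<in> coords" "x = encode s"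
      using x bij_encode by (metis bij_betw_imp_surj_on imageE)
    obtain s' where s': "s' \<in> coords" "y = encode s'"
      using y bij_encode by (metis bij_betw_imp_surj_on imageE)
    have "op_mult N encoder (op_adjoint encoder) x y =
        (\<Sum>r\<in>coords. cnj (block_fourier r s') * block_fourier r s)"
      unfolding op_mult_def op_adjoint_def encoder_def sum_concat
      by (intro sum.cong refl) (use s s' in \<open>simp add: blocks_concat block_fourier_commute mult.commute\<close>)
    also have "\<dots> = (if s' = s then 1 else 0)"
      using block_fourier_orthogonality s s' by simp
    also have "\<dots> = (if x = y then 1 else 0)"
      using s s' bij_encode by (auto simp: bij_betw_def inj_on_def)
    finally show ?thesis .
  qed
  ultimately show ?thesis
    by (simp add: unitary_op_def)
qed

lemma ea_code_encoded: "ea_code N K c (range encoded)"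
proof -
  have "encoded = (\<lambda>\<phi>. apply_channel N c encoder (input_state N K c \<phi>))"
    by (simp add: fun_eq_iff encoded_def)
  moreover have "K + c \<le> N"
    by (simp add: N_eq)
  ultimately show ?thesis
    using unitary_encoder unfolding ea_code_def by (intro conjI exI[of _ encoder]) simp_all
qed

lemma entangled_pairs_eq:
  assumes "z \<in> words n" "w \<in> words n"
  shows "entangled_pairs n z (w :: 'a list) =
    (if z = w then (1 / complex_of_real (sqrt (real CARD('a)))) ^ n else 0)"
proof (cases "z = w")
  case False
  then obtain r where "r < n" "z ! r \<noteq> w ! r"
    using assms by (metis words_iff nth_equalityI)
  then show ?thesis
    using False unfolding entangled_pairs_def by (auto intro!: prod_zero)
qed (simp add: entangled_pairs_def)

text \<open>The Fourier transform spreads the zero ancillas evenly over \<open>u\<close>, the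
  remaining ancillas keep \<open>t\<close> at zero, and the entangled pairs force
  \<open>z = w\<close>.\<close>

lemma encoded_encode:
  assumes "i \<in> words K" "u \<in> words h" "t \<in> words h" "z \<in> words c" "w \<in> words c"
  shows "encoded \<phi> (enc i u t z, w) = (if t = zeros h \<and> z = w then amplitude * \<phi> i else 0)"
proof -
  have mem: "(i, u, t, z) \<in> coords"
    using assms by (simp add: coords_def)
  have inv: "inv_into coords encode (enc i u t z) = (i, u, t, z)"
    using inv_encode[OF mem] by (simp add: encode_def)
  have input: "input_state N K c \<phi> (concat_blocks (i', u', t', z'), w) =
      (if u' = zeros h then if t' = zeros h then if z' = w
       then \<phi> i' * (1 / complex_of_real (sqrt (real CARD('a)))) ^ c else 0 else 0 else 0)"
    if "i' \<in> words K" "u' \<in> words h" "t' \<in> words h" "z' \<in> words c" for i' u' t' z'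
  proof -
    have "(u' @ t' = replicate (h + h) 0) = (u' = zeros h \<and> t' = zeros h)"
      using that by (simp add: replicate_add)
    then show ?thesis
      using that assms(5) by (simp add: input_state_def concat_blocks_def N_eq entangled_pairs_eq)
  qed
  have "encoded \<phi> (enc i u t z, w) =
      (\<Sum>s\<in>coords. block_fourier (i, u, t, z) s * input_state N K c \<phi> (concat_blocks s, w))"
    unfolding encoded_def apply_channel_def sum_concat
    using assms enc_words by (simp add: encoder_def inv blocks_concat cong: sum.cong)
  also have "\<dots> = (\<Sum>u'\<in>words h. block_fourier (i, u, t, z) (i, u', t, z) *
      input_state N K c \<phi> (concat_blocks (i, u', t, z), w))"
    using assms by (intro sum_coords_fibre) (auto simp: block_fourier_def)
  also have "\<dots> = (\<Sum>u'\<in>words h. if u' = (zeros h :: 'a list)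
      then (if t = zeros h \<and> z = w then amplitude * \<phi> i else 0) else 0)"
    by (intro sum.cong refl) (use assms in \<open>simp add: input block_fourier_def fourier_def amplitude_def\<close>)
  also have "\<dots> = (if t = zeros h \<and> z = w then amplitude * \<phi> i else 0)"
    by simp
  finally show ?thesis .
qed

section \<open>Matrix elements of errors between encoded states\<close>

lemma inner_error:
  assumes "a \<in> words N" "b \<in> words N"
  shows "state_inner N c \<psi>' (apply_channel N c (error_op \<gamma> N r a b) \<psi>) =
    \<gamma> ^ r * (\<Sum>y\<in>words N. \<Sum>w\<in>words c. cnj (\<psi>' (vadd y a, w)) * (\<chi> (dot b y) * \<psi> (y, w)))"
proof -
  have err: "error_op \<gamma> N r a b x y = (if x = vadd y a then \<gamma> ^ r * \<chi> (dot b y) else 0)"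
    if "y \<in> words N" for x y
  proof -
    have "op_mult N (shift_op a) (phase_op \<gamma> b) x y =
        (\<Sum>z\<in>words N. if z = y then (if x = vadd y a then \<chi> (dot b y) else 0) else 0)"
      unfolding op_mult_def by (intro sum.cong refl) (simp add: shift_op_def phase_op_def additive_char_def)
    also have "\<dots> = (if x = vadd y a then \<chi> (dot b y) else 0)"
      using that by (subst sum.delta) simp_all
    finally show ?thesis
      by (simp add: error_op_def)
  qed
  have "state_inner N c \<psi>' (apply_channel N c (error_op \<gamma> N r a b) \<psi>) =
      (\<Sum>x\<in>words N. \<Sum>w\<in>words c. \<Sum>y\<in>words N. if x = vadd y a
         then cnj (\<psi>' (vadd y a, w)) * (\<gamma> ^ r * \<chi> (dot b y) * \<psi> (y, w)) else 0)"
    unfolding state_inner_def apply_channel_def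
    by (intro sum.cong refl) (auto simp: sum_distrib_left err intro!: sum.cong)
  also have "\<dots> = (\<Sum>y\<in>words N. \<Sum>w\<in>words c. \<Sum>x\<in>words N. if x = vadd y a
         then cnj (\<psi>' (vadd y a, w)) * (\<gamma> ^ r * \<chi> (dot b y) * \<psi> (y, w)) else 0)"
    by (subst sum.swap, subst (2) sum.swap, subst sum.swap) (rule refl)
  also have "\<dots> = (\<Sum>y\<in>words N. \<Sum>w\<in>words c.
      cnj (\<psi>' (vadd y a, w)) * (\<gamma> ^ r * \<chi> (dot b y) * \<psi> (y, w)))"
    by (intro sum.cong refl, subst sum.delta) (use assms in simp_all)
  finally show ?thesis
    by (simp add: sum_distrib_left mult_ac)
qed

lemma inner_error_identity:
  fixes \<psi>' \<psi> :: "'a state"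
  shows "state_inner N c \<psi>' (apply_channel N c (error_op \<gamma> N r (zeros N) (zeros N)) \<psi>) =
    \<gamma> ^ r * state_inner N c \<psi>' \<psi>"
proof -
  have "(\<Sum>y\<in>words N. \<Sum>w\<in>words c. cnj (\<psi>' (vadd y (zeros N), w)) * (\<chi> (dot (zeros N) y) * \<psi> (y, w))) =
      state_inner N c \<psi>' \<psi>"
    unfolding state_inner_def by (intro sum.cong refl) simp
  then show ?thesis
    by (subst inner_error) simp_all
qed

text \<open>Every term vanishes: a nonzero \<open>ta\<close> moves words out of the support
  \<open>t = zeros h\<close>, and a nonzero \<open>za\<close> destroys the agreement of
  \<open>z\<close> with the receiver's word.\<close>

lemma inner_error_encoded_eq_0:
  assumes "ia \<in> words K" "ua \<in> words h" "ta \<in> words h" "za \<in> words c" and b: "b \<in> words N"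
    and nz: "ta \<noteq> zeros h \<or> za \<noteq> zeros c"
  shows "state_inner N c (encoded \<phi>')
    (apply_channel N c (error_op \<gamma> N r (enc ia ua ta za) b) (encoded \<phi>)) = 0"
proof -
  have "cnj (encoded \<phi>' (vadd (enc i u t z) (enc ia ua ta za), w)) *
      (\<chi> (dot b (enc i u t z)) * encoded \<phi> (enc i u t z, w)) = 0"
    if "i \<in> words K" "u \<in> words h" "t \<in> words h" "z \<in> words c" "w \<in> words c" for i u t z w
  proof (cases "t = zeros h \<and> z = w")
    case True
    then have "vadd t ta \<noteq> zeros h \<or> vadd z za \<noteq> w"
      using nz that assms(1-4) by (auto simp: vadd_eq_self_iff)
    then show ?thesis
      using that assms(1-4) by (auto simp: enc_add[symmetric] encoded_encode)
  next
    case False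
    then show ?thesis
      using that by (auto simp: encoded_encode)
  qed
  then have "(\<Sum>y\<in>words N. \<Sum>w\<in>words c. cnj (encoded \<phi>' (vadd y (enc ia ua ta za), w)) *
      (\<chi> (dot b y) * encoded \<phi> (y, w))) = 0"
    unfolding sum_encode sum_coords encode_def prod.case by (intro sum.neutral ballI)
  then show ?thesis
    using assms enc_words by (subst inner_error) simp_all
qed

text \<open>The character sum of \<open>b\<close> over the dual of the second code.\<close>

definition phase_sum :: "'a list \<Rightarrow> complex" where
  "phase_sum b = (\<Sum>(u, z)\<in>words h \<times> words c. \<chi> (dot b (enc (zeros K) u (zeros h) z)))"

text \<open>A shift in the first code preserves both \<open>t = zeros h\<close> and
  \<open>z = w\<close>. As \<open>enc\<close> is additive, the character splits into a factor
  depending on \<open>i\<close> and one depending on \<open>u\<close> and \<open>z\<close>; the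
  latter sums to \<open>phase_sum b\<close>.\<close>

lemma inner_error_encoded:
  assumes a: "ia \<in> words K" "ua \<in> words h" and b: "b \<in> words N"
  shows "state_inner N c (encoded \<phi>')
      (apply_channel N c (error_op \<gamma> N r (enc ia ua (zeros h) (zeros c)) b) (encoded \<phi>)) =
    \<gamma> ^ r * (cnj amplitude * amplitude * (\<Sum>i\<in>words K. cnj (\<phi>' (vadd i ia)) * \<phi> i *
      \<chi> (dot b (enc i (zeros h) (zeros h) (zeros c)))) * phase_sum b)"
proof -
  let ?\<alpha> = "cnj amplitude * amplitude"
  let ?g = "\<lambda>i. cnj (\<phi>' (vadd i ia)) * \<phi> i * \<chi> (dot b (enc i (zeros h) (zeros h) (zeros c)))"
  let ?f = "\<lambda>u z. \<chi> (dot b (enc (zeros K) u (zeros h) z))"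
  have "(\<Sum>w\<in>words c. cnj (encoded \<phi>' (vadd (enc i u t z) (enc ia ua (zeros h) (zeros c)), w)) *
      (\<chi> (dot b (enc i u t z)) * encoded \<phi> (enc i u t z, w))) =
      (if t = zeros h then ?\<alpha> * (?g i * ?f u z) else 0)" (is "sum ?s _ = _")
    if mem: "i \<in> words K" "u \<in> words h" "t \<in> words h" "z \<in> words c" for i u t z
  proof -
    have split: "\<chi> (dot b (enc i u (zeros h) z)) =
        \<chi> (dot b (enc i (zeros h) (zeros h) (zeros c))) * ?f u z"
    proof -
      have words: "enc i (zeros h) (zeros h) (zeros c) \<in> words N" "enc (zeros K) u (zeros h) z \<in> words N"
        using mem by simp_all
      have "enc i u (zeros h) z = vadd (enc i (zeros h) (zeros h) (zeros c)) (enc (zeros K) u (zeros h) z)"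
        using mem enc_add[of i "zeros h" "zeros h" "zeros c" "zeros K" u "zeros h" z] by simp
      then show ?thesis
        using words b by (simp add: dot_vadd_right[of _ N] additive_char_add)
    qed
    have "sum ?s (words c) = (\<Sum>w\<in>words c. if w = z then
        (if t = zeros h then ?\<alpha> * (?g i * ?f u z) else 0) else 0)"
      by (intro sum.cong refl) (use mem a in \<open>simp add: enc_add[symmetric] encoded_encode split\<close>)
    then show ?thesis
      using mem by simp
  qed
  then have "(\<Sum>y\<in>words N. \<Sum>w\<in>words c.
      cnj (encoded \<phi>' (vadd y (enc ia ua (zeros h) (zeros c)), w)) *
      (\<chi> (dot b y) * encoded \<phi> (y, w))) =
      (\<Sum>i\<in>words K. \<Sum>u\<in>words h. \<Sum>t\<in>words h. \<Sum>z\<in>words c.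
        (if t = (zeros h :: 'a list) then ?\<alpha> * (?g i * ?f u z) else 0))"
    unfolding sum_encode sum_coords encode_def prod.case by (intro sum.cong refl)
  also have "\<dots> = (\<Sum>i\<in>words K. \<Sum>u\<in>words h. \<Sum>z\<in>words c. ?\<alpha> * (?g i * ?f u z))"
    by (rule sum.cong[OF refl], rule sum.cong[OF refl], subst sum.swap) simp
  also have "\<dots> = (\<Sum>i\<in>words K. ?\<alpha> * ?g i * phase_sum b)"
    unfolding phase_sum_def sum.cartesian_product[symmetric] sum_distrib_left
    by (simp only: mult.assoc)
  also have "\<dots> = ?\<alpha> * (\<Sum>i\<in>words K. ?g i) * phase_sum b"
    by (simp add: sum_distrib_left sum_distrib_right mult.assoc)
  finally show ?thesis
    using a b enc_words by (subst inner_error) simp_all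
qed

lemma phase_sum_zeros: "phase_sum (zeros N) \<noteq> 0"
proof -
  have "phase_sum (zeros N) = (\<Sum>s\<in>(words h \<times> words c :: ('a list \<times> 'a list) set). 1)"
    unfolding phase_sum_def by (intro sum.cong refl) auto
  then show ?thesis
    by (simp add: card_cartesian_product card_words split_def)
qed

text \<open>A character that is nontrivial on a group of words sums to zero over it.\<close>

lemma phase_sum_eq_0:
  assumes b: "b \<in> words N" and u0: "u0 \<in> words h" and z0: "z0 \<in> words c"
    and ne: "\<chi> (dot b (enc (zeros K) u0 (zeros h) z0)) \<noteq> 1"
  shows "phase_sum b = 0"
  unfolding phase_sum_def
proof (rule sum_eq_0_if_translate[OF _ _ ne])
  show "bij_betw (map_prod (\<lambda>u. vadd u u0) (\<lambda>z. vadd z z0)) (words h \<times> words c) (words h \<times> words c)"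
    using u0 z0 by (intro bij_betw_map_prod bij_betw_vadd)
  fix s :: "'a list \<times> 'a list"
  assume "s \<in> words h \<times> words c"
  then obtain u z where s: "s = (u, z)" "u \<in> words h" "z \<in> words c"
    by blast
  have words: "enc (zeros K) u0 (zeros h) z0 \<in> words N" "enc (zeros K) u (zeros h) z \<in> words N"
    using s u0 z0 by simp_all
  have "enc (zeros K) (vadd u u0) (zeros h) (vadd z z0) =
      vadd (enc (zeros K) u (zeros h) z) (enc (zeros K) u0 (zeros h) z0)"
    using s u0 z0 enc_add[of "zeros K" u "zeros h" z "zeros K" u0 "zeros h" z0] by simp
  then show "(case map_prod (\<lambda>u. vadd u u0) (\<lambda>z. vadd z z0) s of
        (u, z) \<Rightarrow> \<chi> (dot b (enc (zeros K) u (zeros h) z))) =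
      \<chi> (dot b (enc (zeros K) u0 (zeros h) z0)) *
      (case s of (u, z) \<Rightarrow> \<chi> (dot b (enc (zeros K) u (zeros h) z)))"
    using words b by (simp add: s dot_vadd_right[of _ N] additive_char_add)
qed

end

text \<open>The first assumption bounds the distance of the first code from below. The second says
  the same of the second code: a light nonzero \<open>b\<close> is not orthogonal to its dual, and
  its products there take every value \<open>\<alpha>\<close>, so also one with a nontrivial
  character. The third provides a word of weight \<open>d\<close> in the first code, outside the
  intersection if \<open>K\<close> is positive.\<close>

locale css_code = css_encoder field_type p e \<gamma> N K h c enc
  for field_type :: "'a::finite_field itself" and p e \<gamma> N K h c enc +
  fixes d :: nat
  assumes shift_distance: "\<lbrakk>i \<in> words K; u \<in> words h;
        hamming_weight N (enc i u (zeros h) (zeros c)) < d\<rbrakk> \<Longrightarrow>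
      enc i u (zeros h) (zeros c) = zeros N"
    and phase_distance: "\<lbrakk>b \<in> words N; b \<noteq> zeros N; hamming_weight N b < d\<rbrakk> \<Longrightarrow>
      \<exists>u\<in>words h. \<exists>z\<in>words c. dot b (enc (zeros K) u (zeros h) z) = \<alpha>"
    and low_weight: "\<exists>i\<in>words K. \<exists>u\<in>words h. (K = 0 \<or> i \<noteq> zeros K) \<and>
      hamming_weight N (enc i u (zeros h) (zeros c)) = d"
    and d_pos: "d > 0"
begin

section \<open>Minimum distance of the encoded subspace\<close>

lemma detected_error:
  assumes a: "a \<in> words N" and b: "b \<in> words N" and wt: "error_weight N a b < d"
    and nz: "a \<noteq> zeros N \<or> b \<noteq> zeros N"
  shows "state_inner N c (encoded \<phi>') (apply_channel N c (error_op \<gamma> N r a b) (encoded \<phi>)) = 0"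
proof -
  have "hamming_weight N a \<le> error_weight N a b" "hamming_weight N b \<le> error_weight N a b"
    unfolding error_weight_def by (intro card_mono; auto)+
  then have wa: "hamming_weight N a < d" and wb: "hamming_weight N b < d"
    using wt by auto
  obtain s where "s \<in> coords" "a = encode s"
    using a bij_encode by (metis bij_betw_imp_surj_on imageE)
  then obtain i u t z where s: "i \<in> words K" "u \<in> words h" "t \<in> words h" "z \<in> words c" "a = enc i u t z"
    by (auto simp: coords_def encode_def)
  \<comment> \<open>A shift outside the first code misses the support. A shift inside it is zero by
    its weight, so a nonzero phase error remains, whose character sum vanishes.\<close>
  show ?thesis
  proof (cases "t = zeros h \<and> z = zeros c")
    case False
    then show ?thesis
      using inner_error_encoded_eq_0 s b by blast
  next
    case True
    then have "a = zeros N"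
      using shift_distance s wa by metis
    then have "b \<noteq> zeros N"
      using nz by blast
    obtain \<alpha> where \<alpha>: "\<chi> \<alpha> \<noteq> 1"
      using additive_char_nontrivial by blast
    have "phase_sum b = 0"
      using phase_distance[OF b \<open>b \<noteq> zeros N\<close> wb, of \<alpha>] phase_sum_eq_0[OF b] \<alpha> by blast
    then show ?thesis
      using inner_error_encoded[OF s(1,2) b] True s(5) by simp
  qed
qed

text \<open>The error with zero shift and zero phase is the only one left by
  \<open>detected_error\<close>. Its weight \<open>0\<close> excludes it for \<open>K = 0\<close>;
  otherwise the orthogonality of the two states settles it.\<close>

lemma distance_condition_encoded: "distance_condition \<gamma> N K c (range encoded) d"
proof -
  have detected: "state_inner N c \<psi>' (apply_channel N c (error_op \<gamma> N r a b) \<psi>) = 0"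
    if "\<psi>' \<in> range encoded" "\<psi> \<in> range encoded" "a \<in> words N" "b \<in> words N" "error_weight N a b < d"
      "a = zeros N \<and> b = zeros N \<Longrightarrow> state_inner N c \<psi>' \<psi> = 0" for \<psi>' \<psi> r a b
  proof (cases "a = zeros N \<and> b = zeros N")
    case True
    then show ?thesis
      using that(6) inner_error_identity[of \<psi>' r \<psi>] by simp
  next
    case False
    then show ?thesis
      using that(1,2) detected_error[OF that(3-5)] by blast
  qed
  have w0: "error_weight N (zeros N) (zeros N :: 'a list) = 0"
    by (simp add: error_weight_def)
  show ?thesis
    unfolding distance_condition_def
    by (split if_split, intro conjI ballI allI impI; rule detected) (use w0 in auto)
qed

text \<open>The word of weight \<open>d\<close> serves as a pure shift: it carries the encoded state
  of \<open>zeros K\<close> to that of \<open>i\<close>. These states are orthogonal for positive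
  \<open>K\<close> and equal for \<open>K = 0\<close>, so either form of the condition fails beyond
  \<open>d\<close>.\<close>

lemma distance_condition_le:
  assumes "distance_condition \<gamma> N K c (range encoded) d'"
  shows "d' \<le> d"
proof (rule ccontr)
  assume "\<not> d' \<le> d"
  obtain i u where iu: "i \<in> words K" "u \<in> words h" "K = 0 \<or> i \<noteq> zeros K"
    and wt: "hamming_weight N (enc i u (zeros h) (zeros c)) = d"
    using low_weight by blast
  define a where "a = enc i u (zeros h) (zeros c)"
  define \<phi>' where "\<phi>' j = (if j = i then 1 else 0 :: complex)" for j
  define \<phi> where "\<phi> j = (if j = zeros K then 1 else 0 :: complex)" for j :: "'a list"
  have a: "a \<in> words N"
    using iu by (simp add: a_def)
  have "error_weight N a (zeros N) = hamming_weight N a"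
    unfolding error_weight_def by (intro arg_cong[of _ _ card]) auto
  then have wa: "error_weight N a (zeros N) = d"
    using wt by (simp add: a_def)
  have K0: "encoded \<phi>' = encoded \<phi>" if "K = 0"
  proof -
    have "i = zeros K"
      using iu that by simp
    then have "\<phi>' = \<phi>"
      by (simp add: \<phi>_def \<phi>'_def fun_eq_iff)
    then show ?thesis
      by simp
  qed
  have orth: "state_inner N c (encoded \<phi>') (encoded \<phi>) = 0" if "K \<noteq> 0"
  proof -
    have zero: "enc (zeros K) (zeros h) (zeros h) (zeros c) = zeros N"
    proof -
      have "vadd (enc (zeros K) (zeros h) (zeros h) (zeros c)) (enc (zeros K) (zeros h) (zeros h) (zeros c)) =
          enc (zeros K) (zeros h) (zeros h) (zeros c)"
        by (simp flip: enc_add)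
      moreover have "enc (zeros K) (zeros h) (zeros h) (zeros c) \<in> words N"
        by simp
      ultimately show ?thesis
        using vadd_eq_self_iff by (metis words_iff)
    qed
    have "cnj (\<phi>' j) * \<phi> j = 0" for j
      using iu that by (auto simp: \<phi>_def \<phi>'_def)
    then have "(\<Sum>j\<in>words K. cnj (\<phi>' (vadd j (zeros K))) * \<phi> j *
        \<chi> (dot (zeros N) (enc j (zeros h) (zeros h) (zeros c)))) = 0"
      by (intro sum.neutral) simp
    \<comment> \<open>The inner product is read off from the formula for errors, taken at the
      identity error.\<close>
    then show ?thesis
      using inner_error_encoded[of "zeros K" "zeros h" "zeros N" \<phi>' 0 \<phi>]
        inner_error_identity[of "encoded \<phi>'" 0 "encoded \<phi>"] by (simp add: zero)
  qed
  have "(\<Sum>j\<in>words K. cnj (\<phi>' (vadd j i)) * \<phi> j * \<chi> (dot (zeros N) (enc j (zeros h) (zeros h) (zeros c)))) =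
      (\<Sum>j\<in>words K. if j = (zeros K :: 'a list) then 1 else 0)"
    by (intro sum.cong refl) (use iu enc_words in \<open>simp add: \<phi>_def \<phi>'_def\<close>)
  also have "\<dots> = 1"
    by simp
  finally have undetected: "state_inner N c (encoded \<phi>')
      (apply_channel N c (error_op \<gamma> N 0 a (zeros N)) (encoded \<phi>)) \<noteq> 0"
    using iu amplitude_nonzero phase_sum_zeros
    unfolding a_def by (subst inner_error_encoded) simp_all
  have zN: "zeros N \<in> (words N :: 'a list set)"
    by simp
  have wd: "1 \<le> error_weight N a (zeros N) \<and> error_weight N a (zeros N) < d'"
    using wa d_pos \<open>\<not> d' \<le> d\<close> by simp
  have "state_inner N c (encoded \<phi>')
      (apply_channel N c (error_op \<gamma> N 0 a (zeros N)) (encoded \<phi>)) = 0"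
  proof (cases "K = 0")
    case True
    show ?thesis
      unfolding K0[OF True]
      using assms[unfolded distance_condition_def if_P[OF True]] a zN wd by blast
  next
    case False
    show ?thesis
      using assms[unfolded distance_condition_def if_not_P[OF False]] orth[OF False] a zN wd by blast
  qed
  then show False
    using undetected by blast
qed

theorem eaqecc_encoded: "eaqecc \<gamma> N K d c (range encoded)"
  using ea_code_encoded distance_condition_encoded distance_condition_le
  by (simp add: eaqecc_def min_distance_def)

end

section \<open>Polynomials of bounded degree as words\<close>

lemma coeff_Poly_eq_0: "length xs \<le> m \<Longrightarrow> coeff (Poly xs) m = 0"
  by (simp add: nth_default_beyond)

lemma Poly_vadd:
  "length xs = length ys \<Longrightarrow> Poly (vadd xs ys) = Poly xs + Poly (ys :: 'a::comm_ring_1 list)"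
  by (induction xs ys rule: list_induct2) simp_all

lemma Poly_eq_0_iff_zeros: "length xs = n \<Longrightarrow> Poly xs = 0 \<longleftrightarrow> xs = zeros n"
  by (auto simp: Poly_eq_0)

text \<open>Degree bounds are phrased through vanishing coefficients, which covers the zero
  polynomial and \<open>n = 0\<close> uniformly.\<close>

lemma Poly_of_bounded_degree:
  assumes "\<And>m. n \<le> m \<Longrightarrow> coeff f m = 0"
  obtains xs where "length xs = n" and "f = Poly xs"
proof
  show "length (map (coeff f) [0..<n]) = n"
    by simp
  show "f = Poly (map (coeff f) [0..<n])"
    using assms by (intro poly_eqI) (auto simp: nth_default_def)
qed

lemma degree_less_if_coeff_eq_0:
  "f \<noteq> 0 \<Longrightarrow> (\<And>m. n \<le> m \<Longrightarrow> coeff f m = 0) \<Longrightarrow> degree f < n"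
  by (metis leI leading_coeff_0_iff)

lemma degree_root_product: "degree (\<Prod>s\<in>S. [:- a s, 1:] :: 'a::field poly) = card S"
  by (subst degree_prod_eq_sum_degree) auto

lemma lead_coeff_root_product: "lead_coeff (\<Prod>s\<in>S. [:- a s, 1:] :: 'a::field poly) = 1"
  by (simp add: lead_coeff_prod)

text \<open>The map sending \<open>x\<close> to \<open>x ^ j - x\<close> takes the value
  \<open>0\<close> at both \<open>0\<close> and \<open>1\<close>, so on a finite field it misses
  some \<open>b\<close>; then \<open>x ^ j - x - b\<close> has no root.\<close>

lemma exists_monic_without_roots:
  assumes "2 \<le> j"
  shows "\<exists>P :: 'a::{field, finite} poly. lead_coeff P = 1 \<and> degree P = j \<and> (\<forall>x. poly P x \<noteq> 0)"
proof -
  have "\<not> inj (\<lambda>x :: 'a. x ^ j - x)"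
  proof
    assume "inj (\<lambda>x :: 'a. x ^ j - x)"
    from injD[OF this, of 0 1] show False
      using assms by simp
  qed
  then have "\<not> surj (\<lambda>x :: 'a. x ^ j - x)"
    using finite_UNIV_surj_inj[OF finite_class.finite_UNIV] by blast
  then obtain b where b: "\<And>x :: 'a. x ^ j - x \<noteq> b"
    by (auto simp: surj_def) metis
  define P where "P = monom 1 j + [:- b, - 1:]"
  have less: "degree [:- b, - 1:] < degree (monom (1 :: 'a) j)"
    using assms by (simp add: degree_monom_eq)
  have "degree P = j" "lead_coeff P = 1"
    using less by (simp_all add: P_def degree_add_eq_left lead_coeff_add_le degree_monom_eq
      coeff_eq_0 numeral_2_eq_2)
  moreover have "poly P x \<noteq> 0" for x
    using b[of x] by (simp add: P_def poly_monom algebra_simps)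
  ultimately show ?thesis
    by blast
qed

text \<open>Without roots at the points, multiplication by \<open>P\<close> preserves the weight of
  a word of evaluations. Monicity lets leading coefficients be read off after multiplication by
  \<open>P\<close>.\<close>

locale evaluation_points = finite_field_character field_type p e \<gamma>
  for field_type :: "'a::finite_field itself" and p e :: nat and \<gamma> :: complex +
  fixes M :: nat and a :: "nat \<Rightarrow> 'a" and P :: "'a poly"
  assumes inj_points: "inj_on a {..<M}"
    and monic: "lead_coeff P = 1"
    and no_roots: "s < M \<Longrightarrow> poly P (a s) \<noteq> 0"
begin

section \<open>Evaluation of polynomials at the points\<close>

abbreviation evals :: "'a poly \<Rightarrow> 'a list" where
  "evals f \<equiv> map (\<lambda>s. poly f (a s)) [0..<M]"

lemma P_nonzero: "P \<noteq> 0"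
  using monic by auto

lemma evals_add: "evals (f + g) = vadd (evals f) (evals g)"
  by (intro nth_equalityI) auto

lemma card_roots_le:
  assumes "f \<noteq> 0"
  shows "card {s. s < M \<and> poly f (a s) = 0} \<le> degree f"
proof -
  have "card (a ` {s. s < M \<and> poly f (a s) = 0}) \<le> card {x. poly f x = 0}"
    by (intro card_mono poly_roots_finite assms) auto
  moreover have "card (a ` {s. s < M \<and> poly f (a s) = 0}) = card {s. s < M \<and> poly f (a s) = 0}"
    using inj_points by (intro card_image) (auto simp: inj_on_def)
  ultimately show ?thesis
    using card_poly_roots_bound[OF assms] by simp
qed

lemma card_nonroots: "card {s. s < M \<and> poly f (a s) \<noteq> 0} + card {s. s < M \<and> poly f (a s) = 0} = M"
proof -
  have "{s. s < M \<and> poly f (a s) \<noteq> 0} \<union> {s. s < M \<and> poly f (a s) = 0} = {..<M}"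
    by auto
  then show ?thesis
    by (subst card_Un_disjoint[symmetric]) auto
qed

lemma nonroots_mult:
  "{s. s < M \<and> poly (P * f) (a s) \<noteq> 0} = {s. s < M \<and> poly f (a s) \<noteq> 0}"
  using no_roots by auto

lemma card_nonroots_root_product:
  assumes "k \<le> M"
  shows "card {s. s < M \<and> poly (\<Prod>r<k. [:- a r, 1:]) (a s) \<noteq> 0} = M - k"
proof -
  have "{s. s < M \<and> poly (\<Prod>r<k. [:- a r, 1:]) (a s) \<noteq> 0} = {k..<M}"
  proof (intro equalityI subsetI)
    fix s assume "s \<in> {k..<M}"
    then have "a s \<noteq> a r" if "r < k" for r
      using inj_onD[OF inj_points, of s r] that by auto
    then show "s \<in> {s. s < M \<and> poly (\<Prod>r<k. [:- a r, 1:]) (a s) \<noteq> 0}"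
      using \<open>s \<in> {k..<M}\<close> by (simp add: poly_prod)
  next
    fix s assume s: "s \<in> {s. s < M \<and> poly (\<Prod>r<k. [:- a r, 1:]) (a s) \<noteq> 0}"
    have "poly (\<Prod>r<k. [:- a r, 1:]) (a s) = 0" if "s < k"
      using that by (auto simp: poly_prod intro!: bexI[of _ s])
    then show "s \<in> {k..<M}"
      using s by (cases "s < k") auto
  qed
  then show ?thesis
    by simp
qed

lemma evals_eq_zeros:
  assumes "evals f = zeros M" and "\<And>m. M \<le> m \<Longrightarrow> coeff f m = 0"
  shows "f = 0"
proof (rule ccontr)
  assume "f \<noteq> 0"
  have "poly f (a s) = 0" if "s < M" for s
    using arg_cong[OF assms(1), of "\<lambda>x. x ! s"] that by simp
  then have "{s. s < M \<and> poly f (a s) = 0} = {..<M}"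
    by auto
  then have "M \<le> degree f"
    using card_roots_le[OF \<open>f \<noteq> 0\<close>] by simp
  moreover have "degree f < M"
    using \<open>f \<noteq> 0\<close> assms(2) by (rule degree_less_if_coeff_eq_0)
  ultimately show False
    by simp
qed

lemma coeff_P_mult_eq_0:
  assumes "\<And>m. n \<le> m \<Longrightarrow> coeff f m = 0" and "degree P + n \<le> m"
  shows "coeff (P * f) m = 0"
proof (cases "f = 0")
  case False
  then have "degree f < n"
    using assms(1) by (rule degree_less_if_coeff_eq_0)
  then have "degree (P * f) < m"
    using degree_mult_le[of P f] assms(2) by simp
  then show ?thesis
    by (rule coeff_eq_0)
qed simp

text \<open>A nonzero multiple of \<open>P\<close> has degree at least \<open>degree P\<close>,
  which \<open>Poly z\<close> cannot reach.\<close>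

lemma P_mult_eq_0:
  assumes "Poly z + P * f = 0" and "length z = degree P"
  shows "f = 0"
proof (rule ccontr)
  assume "f \<noteq> 0"
  then have "coeff (P * f) (degree P + degree f) \<noteq> 0"
    using P_nonzero by (simp flip: degree_mult_eq)
  moreover have "coeff (Poly z) (degree P + degree f) = 0"
    using assms(2) by (intro coeff_Poly_eq_0) simp
  ultimately show False
    using assms(1) by (metis add_0 coeff_0 coeff_add)
qed

text \<open>The first two summands fill only the coefficients below
  \<open>length z + length v\<close>, and \<open>t\<close> occupies those above. The total degree
  stays below \<open>M\<close>, so evaluation loses nothing; the summands \<open>z\<close> and
  \<open>v\<close> then separate by degree.\<close>

lemma evals_blocks_kernel:
  assumes lens: "length z = degree P" "length z + length v + length t = M"
    and zero: "evals (Poly z + P * Poly v + monom 1 (length z + length v) * Poly t) = zeros M"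
  shows "z = zeros (length z) \<and> v = zeros (length v) \<and> t = zeros (length t)"
proof -
  define f where "f = Poly z + P * Poly v"
  have "coeff f m = 0" if "length z + length v \<le> m" for m
    using that lens(1) coeff_P_mult_eq_0[of "length v" "Poly v" m]
    by (simp add: f_def coeff_Poly_eq_0 nth_default_beyond)
  then obtain w where w: "length w = length z + length v" "f = Poly w"
    using Poly_of_bounded_degree by blast
  have "f + monom 1 (length z + length v) * Poly t = Poly (w @ t)"
    by (simp add: Poly_append w)
  then have "evals (Poly (w @ t)) = zeros M"
    using zero by (simp add: f_def)
  then have "Poly (w @ t) = 0"
    by (rule evals_eq_zeros) (use w lens(2) in \<open>simp add: nth_default_beyond\<close>)
  then have "w @ t = zeros (length w) @ zeros (length t)"
    by (subst (asm) Poly_eq_0_iff_zeros[of _ "length w + length t"]) (simp_all only: length_append replicate_add)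
  then have wt: "w = zeros (length w) \<and> t = zeros (length t)"
    by (subst (asm) append_eq_append_conv) (rule disjI1, rule length_replicate[symmetric])
  have "f = 0"
    unfolding w(2) using wt Poly_eq_0_iff_zeros by blast
  then have v: "Poly v = 0"
    using P_mult_eq_0 lens(1) by (simp add: f_def)
  then have "Poly z = 0"
    using \<open>f = 0\<close> by (simp add: f_def)
  then show ?thesis
    using v wt Poly_eq_0_iff_zeros by blast
qed

text \<open>Division with remainder by \<open>P\<close>: \<open>z\<close> holds the remainder and
  \<open>u\<close> the quotient.\<close>

lemma division_blocks:
  assumes "\<And>m. degree P + n \<le> m \<Longrightarrow> coeff g m = 0"
  obtains z u where "length z = degree P" "length u = n" "g = Poly z + P * Poly u"
proof -
  have mod: "coeff (g mod P) m = 0" if "degree P \<le> m" for m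
  proof (cases "g mod P = 0")
    case False
    then have "degree (g mod P) < degree P"
      using degree_mod_less[OF P_nonzero] by blast
    then show ?thesis
      using that by (intro coeff_eq_0) simp
  qed simp
  then obtain z where z: "length z = degree P" "g mod P = Poly z"
    using Poly_of_bounded_degree by blast
  have "coeff (g div P) m = 0" if "n \<le> m" for m
  proof (cases "g div P = 0")
    case False
    have "P * (g div P) = g - g mod P"
      by (simp add: minus_mod_eq_mult_div)
    then have "coeff (P * (g div P)) i = 0" if "degree P + n \<le> i" for i
      using that assms mod by simp
    moreover have "P * (g div P) \<noteq> 0"
      using False P_nonzero by simp
    ultimately have "degree (P * (g div P)) < degree P + n"
      by (intro degree_less_if_coeff_eq_0)
    then have "degree (g div P) < n"
      using False P_nonzero by (simp add: degree_mult_eq)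
    then show ?thesis
      using that by (intro coeff_eq_0) simp
  qed simp
  then obtain u where u: "length u = n" "g div P = Poly u"
    using Poly_of_bounded_degree by blast
  have "g = Poly z + P * Poly u"
    using mult_div_mod_eq[of P g] by (simp add: z u add.commute flip: z u)
  then show thesis
    using that z u by blast
qed

text \<open>The polynomial vanishes at all positions of the support of \<open>b\<close> except \<open>s0\<close>.\<close>

lemma separating_polynomial:
  assumes "s0 < M" and "b ! s0 \<noteq> 0"
  obtains g where "\<And>m. card {s. s < M \<and> b ! s \<noteq> 0} \<le> m \<Longrightarrow> coeff g m = 0"
    and "(\<Sum>s<M. b ! s * poly g (a s)) = \<alpha>"
proof -
  define S where "S = {s. s < M \<and> b ! s \<noteq> 0} - {s0}"
  define g0 where "g0 = (\<Prod>s\<in>S. [:- a s, 1:])"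
  define g where "g = smult (\<alpha> / (b ! s0 * poly g0 (a s0))) g0"
  have fin: "finite S"
    by (simp add: S_def)
  have card: "card {s. s < M \<and> b ! s \<noteq> 0} = Suc (card S)"
    using assms unfolding S_def by (subst card_Suc_Diff1) auto
  have "poly g0 (a s0) \<noteq> 0"
    using inj_points assms fin by (auto simp: g0_def poly_prod S_def inj_on_def)
  then have "b ! s0 * poly g (a s0) = \<alpha>"
    using assms by (simp add: g_def)
  moreover have "poly g (a s) = 0" if "s \<in> S" for s
    using that fin by (auto simp: g_def g0_def poly_prod)
  then have "b ! s * poly g (a s) = 0" if "s < M" "s \<noteq> s0" for s
    using that by (cases "b ! s = 0") (auto simp: S_def)
  then have "(\<Sum>s<M. b ! s * poly g (a s)) = (\<Sum>s<M. if s = s0 then b ! s0 * poly g (a s0) else 0)"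
    by (intro sum.cong refl) auto
  ultimately have "(\<Sum>s<M. b ! s * poly g (a s)) = \<alpha>"
    using assms by simp
  moreover have "coeff g m = 0" if "card {s. s < M \<and> b ! s \<noteq> 0} \<le> m" for m
    using that card degree_root_product[of a S] by (simp add: g_def g0_def coeff_eq_0)
  ultimately show thesis
    using that by blast
qed

lemma hamming_weight_evals:
  "hamming_weight M (evals f) = card {s. s < M \<and> poly f (a s) \<noteq> 0}"
  by (intro arg_cong[of _ _ card]) auto

lemma hamming_weight_evals_snoc:
  "hamming_weight (Suc M) (evals f @ [x]) =
    card {s. s < M \<and> poly f (a s) \<noteq> 0} + (if x = 0 then 0 else 1)"
proof -
  have "{r. r < Suc M \<and> (evals f @ [x]) ! r \<noteq> 0} =
      {s. s < M \<and> poly f (a s) \<noteq> 0} \<union> (if x = 0 then {} else {M})"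
    by (auto simp: nth_append less_Suc_eq split: if_splits)
  then show ?thesis
    by (simp add: card_insert_if)
qed

lemma dot_evals:
  "length b = M \<Longrightarrow> dot b (evals g) = (\<Sum>s<M. b ! s * poly g (a s))"
  by (subst dot_sum[of _ M]) auto

lemma dot_evals_snoc:
  "length b = Suc M \<Longrightarrow> dot b (evals g @ [x]) = (\<Sum>s<M. b ! s * poly g (a s)) + b ! M * x"
  by (subst dot_sum[of _ "Suc M"]) (auto simp: nth_append intro!: sum.cong)

text \<open>This supplies codewords of minimum weight; the leading coefficient \<open>1\<close>
  later shows that they lie outside the intersection.\<close>

lemma Poly_root_product:
  obtains v where "length v = Suc k" and "(\<Prod>r<k. [:- a r, 1:]) = Poly v" and "last v = 1"
proof -
  define f where "f = (\<Prod>r<k. [:- a r, 1:])"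
  have deg: "degree f = k"
    using degree_root_product[of a "{..<k}"] by (simp add: f_def)
  have "coeff f m = 0" if "Suc k \<le> m" for m
    using deg that by (simp add: coeff_eq_0)
  then obtain v where v: "length v = Suc k" "f = Poly v"
    using Poly_of_bounded_degree by blast
  have "last v = v ! k"
    using v by (subst last_conv_nth) auto
  also have "\<dots> = coeff f k"
    using v by (simp add: nth_default_nth)
  also have "\<dots> = 1"
    using lead_coeff_root_product[of a "{..<k}"] deg by (simp add: f_def)
  finally show thesis
    using that v by (simp add: f_def)
qed

text \<open>
  The first code consists of the evaluations of the multiples of \<open>P\<close> by a polynomial of degree
  less than \<open>K + h\<close>, the dual of the second one of the evaluations of all polynomials of degree
  less than \<open>h + c\<close>, where \<open>c = degree P\<close>. No reduction modulo the points occurs, so they meet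
  exactly in the multiples of \<open>P\<close> by a polynomial of degree less than \<open>h\<close>.
\<close>

definition affine_enc :: "'a list \<Rightarrow> 'a list \<Rightarrow> 'a list \<Rightarrow> 'a list \<Rightarrow> 'a list" where
  "affine_enc i u t z =
     evals (Poly z + P * Poly (u @ i) + monom 1 (length z + length (u @ i)) * Poly t)"

lemma css_code_affine:
  assumes c: "degree P = c" and M: "M = K + (h + (h + c))" and pos: "K + h \<ge> 1"
  shows "css_code p e \<gamma> M K h c affine_enc (h + c + 1)"
proof unfold_locales
  show "M = K + (h + (h + c))"
    by (rule M)
  show "0 < h + c + 1"
    by simp
next
  fix i u t z :: "'a list"
  show "affine_enc i u t z \<in> words M"
    by (simp add: affine_enc_def)
next
  fix i u t z i' u' t' z' :: "'a list"
  assume mem: "i \<in> words K" "u \<in> words h" "t \<in> words h" "z \<in> words c"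
    "i' \<in> words K" "u' \<in> words h" "t' \<in> words h" "z' \<in> words c"
  then show "affine_enc (vadd i i') (vadd u u') (vadd t t') (vadd z z') =
      vadd (affine_enc i u t z) (affine_enc i' u' t' z')"
    unfolding affine_enc_def evals_add[symmetric]
    by (simp add: Poly_vadd Poly_append algebra_simps)
next
  fix i u t z :: "'a list"
  assume mem: "i \<in> words K" "u \<in> words h" "t \<in> words h" "z \<in> words c"
    and zero: "affine_enc i u t z = zeros M"
  have "z = zeros (length z) \<and> u @ i = zeros (length (u @ i)) \<and> t = zeros (length t)"
    using zero mem c M unfolding affine_enc_def by (intro evals_blocks_kernel) simp_all
  then show "i = zeros K \<and> u = zeros h \<and> t = zeros h \<and> z = zeros c"
    using mem by (simp add: replicate_add)
next
  fix i u :: "'a list"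
  assume mem: "i \<in> words K" "u \<in> words h"
    and wt: "hamming_weight M (affine_enc i u (zeros h) (zeros c)) < h + c + 1"
  have enc: "affine_enc i u (zeros h) (zeros c) = evals (P * Poly (u @ i))"
    by (simp add: affine_enc_def)
  have "Poly (u @ i) = 0"
  proof (rule ccontr)
    assume nz: "Poly (u @ i) \<noteq> 0"
    have "degree (Poly (u @ i)) < h + K"
      by (rule degree_less_if_coeff_eq_0[OF nz]) (use mem in \<open>simp add: nth_default_beyond\<close>)
    \<comment> \<open>At most \<open>K + h - 1\<close> of the \<open>M\<close> points are roots,
      which leaves at least \<open>h + c + 1\<close>.\<close>
    then have "card {s. s < M \<and> poly (Poly (u @ i)) (a s) \<noteq> 0} \<ge> h + c + 1"
      using card_roots_le[OF nz] card_nonroots[of "Poly (u @ i)"] M by linarith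
    then show False
      using wt unfolding enc hamming_weight_evals nonroots_mult by simp
  qed
  then show "affine_enc i u (zeros h) (zeros c) = zeros M"
    unfolding enc by (simp add: map_replicate_const)
next
  fix b :: "'a list" and \<alpha> :: 'a
  assume b: "b \<in> words M" "b \<noteq> zeros M" and wt: "hamming_weight M b < h + c + 1"
  obtain s0 where "s0 < M" "b ! s0 \<noteq> 0"
    using b by (auto simp: list_eq_iff_nth_eq)
  then obtain g where g: "\<And>m. card {s. s < M \<and> b ! s \<noteq> 0} \<le> m \<Longrightarrow> coeff g m = 0"
    "(\<Sum>s<M. b ! s * poly g (a s)) = \<alpha>"
    using separating_polynomial by blast
  \<comment> \<open>The weight of \<open>b\<close> is at most \<open>h + c\<close>, so
    \<open>g\<close> has few enough coefficients for its remainder and quotient to fit into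
    \<open>z\<close> and \<open>u\<close>.\<close>
  have "coeff g m = 0" if "degree P + h \<le> m" for m
    using g(1) wt that c by simp
  then obtain z u where zu: "length z = degree P" "length u = h" "g = Poly z + P * Poly u"
    using division_blocks by blast
  then have "affine_enc (zeros K) u (zeros h) z = evals g"
    by (simp add: affine_enc_def)
  then have "dot b (affine_enc (zeros K) u (zeros h) z) = \<alpha>"
    using g(2) b dot_evals by simp
  then show "\<exists>u\<in>words h. \<exists>z\<in>words c. dot b (affine_enc (zeros K) u (zeros h) z) = \<alpha>"
    using zu c by (intro bexI[of _ u] bexI[of _ z]) simp_all
next
  \<comment> \<open>A multiplier with \<open>K + h - 1\<close> roots among the points attains the
    bound. Its leading coefficient falls into the block \<open>i\<close> when \<open>K\<close> is
    positive.\<close>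
  obtain v where v: "length v = Suc (K + h - 1)" "(\<Prod>r<K + h - 1. [:- a r, 1:]) = Poly v" "last v = 1"
    using Poly_root_product by blast
  define i where "i = drop h v"
  define u where "u = take h v"
  have len: "length i = K" "length u = h"
    using v(1) pos by (simp_all add: i_def u_def)
  have "affine_enc i u (zeros h) (zeros c) = evals (P * Poly v)"
    by (simp add: affine_enc_def i_def u_def)
  moreover have "card {s. s < M \<and> poly (Poly v) (a s) \<noteq> 0} = h + c + 1"
    using card_nonroots_root_product[of "K + h - 1"] v(2) M pos by simp
  ultimately have "hamming_weight M (affine_enc i u (zeros h) (zeros c)) = h + c + 1"
    by (simp only: hamming_weight_evals nonroots_mult)
  moreover have "i \<noteq> zeros K" if "K \<noteq> 0"
  proof
    assume "i = zeros K"
    moreover have "last i = 1"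
      using v len that by (simp add: i_def last_drop)
    ultimately show False
      using that by simp
  qed
  ultimately show "\<exists>i\<in>words K. \<exists>u\<in>words h. (K = 0 \<or> i \<noteq> zeros K) \<and>
      hamming_weight M (affine_enc i u (zeros h) (zeros c)) = h + c + 1"
    using len by (intro bexI[of _ i] bexI[of _ u]) auto
qed

text \<open>
  Both codes are now extended by the coordinate of the leading coefficient at infinity, the
  first one with weight \<open>\<beta>\<close>. Because \<open>\<beta> \<noteq> 1\<close>, the leading coefficients of a common
  codeword vanish, so that again exactly the multiples of \<open>P\<close> by polynomials of degree less
  than \<open>h\<close> (with value \<open>0\<close> at infinity) are common to both. The head of \<open>z\<close> is the leading
  coefficient in the second code.
\<close>

definition extended_enc :: "'a \<Rightarrow> 'a list \<Rightarrow> 'a list \<Rightarrow> 'a list \<Rightarrow> 'a list \<Rightarrow> 'a list" where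
  "extended_enc \<beta> i u t z =
     evals (Poly (tl z) + P * (Poly (u @ i) + monom (hd z) (length u)) +
       monom 1 (length (tl z) + length (u @ i)) * Poly t) @ [hd z + \<beta> * last i]"

text \<open>For zero \<open>i\<close> and \<open>t\<close> the polynomial has coefficient
  \<open>hd z\<close> at degree \<open>h + j\<close> and none above; for zero \<open>z\<close> and
  \<open>t\<close> the leading position of the multiplier of \<open>P\<close> holds
  \<open>last i\<close>. These are the values at infinity, up to the weight
  \<open>\<beta>\<close>.\<close>

lemma css_code_extended:
  assumes j: "degree P = j" and c: "c = Suc j" and M: "M = K + (h + (h + j))" and K: "K \<ge> 1"
    and \<beta>: "\<beta> \<noteq> 0" "\<beta> \<noteq> 1"
  shows "css_code p e \<gamma> (Suc M) K h c (extended_enc \<beta>) (h + c + 1)"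
proof unfold_locales
  show "Suc M = K + (h + (h + c))"
    by (simp add: M c)
  show "0 < h + c + 1"
    by simp
next
  fix i u t z :: "'a list"
  show "extended_enc \<beta> i u t z \<in> words (Suc M)"
    by (simp add: extended_enc_def)
next
  fix i u t z i' u' t' z' :: "'a list"
  assume mem: "i \<in> words K" "u \<in> words h" "t \<in> words h" "z \<in> words c"
    "i' \<in> words K" "u' \<in> words h" "t' \<in> words h" "z' \<in> words c"
  obtain x y where z: "z = x # y" "length y = j"
    using mem(4) c by (auto simp: length_Suc_conv)
  obtain x' y' where z': "z' = x' # y'" "length y' = j"
    using mem(8) c by (auto simp: length_Suc_conv)
  have last_add: "last (vadd i i') = last i + last i'"
    using mem K by (subst (1 2 3) last_conv_nth) auto
  define F where "F i u t y x = Poly y + P * (Poly (u @ i) + monom x h) +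
      monom 1 (j + (h + K)) * Poly t" for i u t y x
  have "F (vadd i i') (vadd u u') (vadd t t') (vadd y y') (x + x') = F i u t y x + F i' u' t' y' x'"
    using mem z z' by (simp add: F_def Poly_vadd Poly_append algebra_simps add_monom[symmetric])
  moreover have "extended_enc \<beta> i u t z = evals (F i u t y x) @ [x + \<beta> * last i]"
    "extended_enc \<beta> i' u' t' z' = evals (F i' u' t' y' x') @ [x' + \<beta> * last i']"
    "extended_enc \<beta> (vadd i i') (vadd u u') (vadd t t') (vadd z z') =
      evals (F (vadd i i') (vadd u u') (vadd t t') (vadd y y') (x + x')) @
        [(x + x') + \<beta> * last (vadd i i')]"
    using mem z z' by (simp_all add: extended_enc_def F_def)
  ultimately show "extended_enc \<beta> (vadd i i') (vadd u u') (vadd t t') (vadd z z') =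
      vadd (extended_enc \<beta> i u t z) (extended_enc \<beta> i' u' t' z')"
    using last_add by (simp only: evals_add) (simp add: zip_append algebra_simps)
next
  fix i u t z :: "'a list"
  assume mem: "i \<in> words K" "u \<in> words h" "t \<in> words h" "z \<in> words c"
    and zero: "extended_enc \<beta> i u t z = zeros (Suc M)"
  obtain x y where z: "z = x # y" "length y = j"
    using mem(4) c by (auto simp: length_Suc_conv)
  \<comment> \<open>The head \<open>x\<close> of \<open>z\<close> and the first entry of
    \<open>i\<close> belong to the same power in the multiplier of \<open>P\<close>, so the finite
    points see only their sum.\<close>
  define v where "v = vadd (u @ i) (zeros h @ x # zeros (K - 1))"
  have lv: "length v = h + K"
    using mem K by (simp add: v_def)
  have "Poly (zeros h @ x # zeros (K - 1)) = monom x h"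
    by (simp add: Poly_append mult_monom flip: monom_0)
  then have "Poly v = Poly (u @ i) + monom x h"
    using mem K unfolding v_def by (subst Poly_vadd) simp_all
  then have enc: "extended_enc \<beta> i u t z =
      evals (Poly y + P * Poly v + monom 1 (length y + length v) * Poly t) @ [x + \<beta> * last i]"
    using mem lv by (simp add: extended_enc_def z)
  have "evals (Poly y + P * Poly v + monom 1 (length y + length v) * Poly t) = zeros M"
    and last: "x + \<beta> * last i = 0"
    using zero unfolding enc replicate_Suc replicate_append_same[symmetric] by simp_all
  then have yvt: "y = zeros (length y) \<and> v = zeros (length v) \<and> t = zeros (length t)"
    using evals_blocks_kernel[of y v t] mem j z lv M by simp
  have "zeros (h + K) = v"
    using yvt lv by simp
  then have "zeros h @ zeros K = u @ vadd i (x # zeros (K - 1))"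
    using mem by (simp add: v_def replicate_add)
  then have u0: "u = zeros h" and i0: "vadd i (x # zeros (K - 1)) = zeros K"
    using mem K by (simp_all add: append_eq_append_conv)
  obtain i1 i' where i: "i = i1 # i'" "length i' = K - 1"
    using mem(1) K by (cases i) auto
  obtain K' where K': "K = Suc K'"
    using K by (cases K) auto
  have i1: "i1 + x = 0" and i': "i' = zeros (K - 1)"
    using i0 i by (simp_all add: K')
  \<comment> \<open>The coordinate at infinity separates the two summands. If \<open>K = 1\<close>,
    it reads \<open>x - \<beta> * x\<close> and \<open>\<beta> \<noteq> 1\<close> is decisive; if
    \<open>K\<close> is larger, \<open>last i\<close> is already zero.\<close>
  have x0: "x = 0"
  proof (cases "K' = 0")
    case True
    then have "x + \<beta> * i1 = 0"
      using last i K' by simp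
    moreover have "i1 = - x"
      using i1 by (simp add: add_eq_0_iff)
    ultimately have "(1 - \<beta>) * x = 0"
      by (simp add: algebra_simps)
    then show ?thesis
      using \<beta> by simp
  next
    case False
    then show ?thesis
      using last i i' K' by simp
  qed
  then show "i = zeros K \<and> u = zeros h \<and> t = zeros h \<and> z = zeros c"
    using i1 i' u0 yvt mem c unfolding i z K' by simp
next
  fix i u :: "'a list"
  assume mem: "i \<in> words K" "u \<in> words h"
    and wt: "hamming_weight (Suc M) (extended_enc \<beta> i u (zeros h) (zeros c)) < h + c + 1"
  have enc: "extended_enc \<beta> i u (zeros h) (zeros c) = evals (P * Poly (u @ i)) @ [\<beta> * last i]"
    by (simp add: extended_enc_def c)
  have last: "last i = coeff (Poly (u @ i)) (h + (K - 1))"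
    using mem K by (subst last_conv_nth) (auto simp: nth_default_append nth_default_nth)
  have "Poly (u @ i) = 0"
  proof (rule ccontr)
    assume nz: "Poly (u @ i) \<noteq> 0"
    have "degree (Poly (u @ i)) < h + K"
      by (rule degree_less_if_coeff_eq_0[OF nz]) (use mem in \<open>simp add: nth_default_beyond\<close>)
    \<comment> \<open>Either infinity contributes one to the weight, or the degree drops and one
      more finite point is a nonroot.\<close>
    moreover have "degree (Poly (u @ i)) \<noteq> h + (K - 1)" if "last i = 0"
      using nz that unfolding last by (metis leading_coeff_0_iff)
    ultimately have "card {s. s < M \<and> poly (Poly (u @ i)) (a s) \<noteq> 0} +
        (if \<beta> * last i = 0 then 0 else 1) \<ge> h + c + 1"
      using card_roots_le[OF nz] card_nonroots[of "Poly (u @ i)"] M c K \<beta>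
      by (cases "last i = 0") simp_all
    then show False
      using wt unfolding enc hamming_weight_evals_snoc nonroots_mult by simp
  qed
  then show "extended_enc \<beta> i u (zeros h) (zeros c) = zeros (Suc M)"
    unfolding enc last by (simp add: map_replicate_const replicate_append_same)
next
  fix b :: "'a list" and \<alpha> :: 'a
  assume b: "b \<in> words (Suc M)" "b \<noteq> zeros (Suc M)" and wt: "hamming_weight (Suc M) b < h + c + 1"
  \<comment> \<open>If \<open>b\<close> is nonzero at infinity and at a finite point, its finite
    support has at most \<open>h + j\<close> positions, so the separating polynomial vanishes at
    infinity. If \<open>b\<close> lives only at infinity, a monomial suffices.\<close>
  obtain g where g: "\<And>m. Suc (h + j) \<le> m \<Longrightarrow> coeff g m = 0"
    "(\<Sum>s<M. b ! s * poly g (a s)) + b ! M * coeff g (h + j) = \<alpha>"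
  proof (cases "\<exists>s0<M. b ! s0 \<noteq> 0")
    case True
    then obtain g where g: "\<And>m. card {s. s < M \<and> b ! s \<noteq> 0} \<le> m \<Longrightarrow> coeff g m = 0"
      "(\<Sum>s<M. b ! s * poly g (a s)) = \<alpha>"
      using separating_polynomial by blast
    have "{s. s < Suc M \<and> b ! s \<noteq> 0} = {s. s < M \<and> b ! s \<noteq> 0} \<union> (if b ! M = 0 then {} else {M})"
      by (auto simp: less_Suc_eq split: if_splits)
    then have card: "hamming_weight (Suc M) b =
        card {s. s < M \<and> b ! s \<noteq> 0} + (if b ! M = 0 then 0 else 1)"
      by (simp add: card_insert_if)
    have "coeff g m = 0" if "Suc (h + j) \<le> m" for m
      using that wt card c by (intro g(1)) linarith
    moreover have "b ! M * coeff g (h + j) = 0"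
      using wt card c by (cases "b ! M = 0") (simp_all add: g(1))
    then have "(\<Sum>s<M. b ! s * poly g (a s)) + b ! M * coeff g (h + j) = \<alpha>"
      using g(2) by simp
    ultimately show thesis
      by (rule that)
  next
    case False
    then have "b ! M \<noteq> 0"
      using b by (auto simp: list_eq_iff_nth_eq less_Suc_eq simp del: replicate_Suc)
    then show thesis
      using False that[of "monom (\<alpha> / b ! M) (h + j)"] by simp
  qed
  have "coeff g m = 0" if "degree P + Suc h \<le> m" for m
    using that j by (intro g(1)) simp
  then obtain y v where yv: "length y = degree P" "length v = Suc h" "g = Poly y + P * Poly v"
    using division_blocks by blast
  define u where "u = butlast v"
  define z where "z = last v # y"
  have v: "v = u @ [last v]" "length u = h"
    using yv(2) by (cases v rule: rev_cases; simp add: u_def)+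
  have Pv: "Poly v = Poly u + monom (last v) h"
    using v by (metis Poly_snoc)
  have "coeff (Poly y) (h + j) = 0"
    using yv(1) j by (intro coeff_Poly_eq_0) simp
  moreover have "coeff (P * Poly u) (h + j) = 0"
    using v(2) j by (intro coeff_P_mult_eq_0[of h] coeff_Poly_eq_0) simp_all
  moreover have "coeff (P * monom (last v) h) (h + j) = last v"
    using monic j by (simp add: mult.commute[of P] coeff_monom_mult)
  ultimately have "coeff g (h + j) = last v"
    unfolding yv(3) Pv by (simp add: distrib_left)
  moreover have "extended_enc \<beta> (zeros K) u (zeros h) z = evals g @ [last v]"
    using K v(2) unfolding extended_enc_def z_def yv(3) Pv by simp
  ultimately have "dot b (extended_enc \<beta> (zeros K) u (zeros h) z) = \<alpha>"
    using g(2) b dot_evals_snoc by simp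
  then show "\<exists>u\<in>words h. \<exists>z\<in>words c. dot b (extended_enc \<beta> (zeros K) u (zeros h) z) = \<alpha>"
    using yv v c j by (intro bexI[of _ u] bexI[of _ z]) (simp_all add: z_def)
next
  obtain v where v: "length v = Suc (K + h - 1)" "(\<Prod>r<K + h - 1. [:- a r, 1:]) = Poly v" "last v = 1"
    using Poly_root_product by blast
  define i where "i = drop h v"
  define u where "u = take h v"
  have len: "length i = K" "length u = h"
    using v(1) K by (simp_all add: i_def u_def)
  have last: "last i = 1"
    using v K by (simp add: i_def last_drop)
  have "extended_enc \<beta> i u (zeros h) (zeros c) = evals (P * Poly v) @ [\<beta>]"
    using last by (simp add: extended_enc_def i_def u_def c)
  moreover have "card {s. s < M \<and> poly (Poly v) (a s) \<noteq> 0} + 1 = h + c + 1"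
    using card_nonroots_root_product[of "K + h - 1"] v(2) M K c by simp
  ultimately have "hamming_weight (Suc M) (extended_enc \<beta> i u (zeros h) (zeros c)) = h + c + 1"
    using \<beta> by (simp only: hamming_weight_evals_snoc nonroots_mult if_False)
  moreover have "i \<noteq> zeros K"
    using last K by auto
  ultimately show "\<exists>i\<in>words K. \<exists>u\<in>words h. (K = 0 \<or> i \<noteq> zeros K) \<and>
      hamming_weight (Suc M) (extended_enc \<beta> i u (zeros h) (zeros c)) = h + c + 1"
    using len by (intro bexI[of _ i] bexI[of _ u]) auto
qed

end

section \<open>The three families\<close>

context finite_field_character
begin

text \<open>If a field element can be spared, the points avoid \<open>0\<close> and a power of
  \<open>X\<close> serves as \<open>P\<close>. If all elements are points, \<open>P\<close> must
  have no roots in the field, whence \<open>2 \<le> j\<close>.\<close>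

lemma exists_evaluation_points:
  assumes "M \<le> CARD('a) - 1 \<or> M \<le> CARD('a) \<and> 2 \<le> j"
  obtains a :: "nat \<Rightarrow> 'a" and P where "evaluation_points p e \<gamma> M a P" and "degree P = j"
proof (cases "M \<le> CARD('a) - 1")
  case True
  then have "card {..<M} \<le> card (UNIV - {0 :: 'a})"
    by (simp add: card_Diff_singleton)
  then obtain a where a: "inj_on a {..<M}" "a ` {..<M} \<subseteq> UNIV - {0 :: 'a}"
    using inj_on_iff_card_le[of "{..<M}" "UNIV - {0 :: 'a}"] by auto
  have "evaluation_points p e \<gamma> M a (monom 1 j)"
    using a by unfold_locales (auto simp: poly_monom degree_monom_eq)
  then show thesis
    using that by (simp add: degree_monom_eq)
next
  case False
  then have M: "card {..<M} \<le> CARD('a)" and j: "2 \<le> j"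
    using assms by auto
  obtain a :: "nat \<Rightarrow> 'a" where a: "inj_on a {..<M}"
    using M inj_on_iff_card_le[of "{..<M}" "UNIV :: 'a set"] by auto
  obtain P :: "'a poly" where P: "lead_coeff P = 1" "degree P = j" "\<And>x. poly P x \<noteq> 0"
    using exists_monic_without_roots[OF j] by blast
  have "evaluation_points p e \<gamma> M a P"
    using a P by unfold_locales auto
  then show thesis
    using that P by blast
qed

lemma exists_mds_affine:
  assumes N: "N = K + (h + (h + c))" and "K + h \<ge> 1"
    and points: "N \<le> CARD('a) - 1 \<or> N \<le> CARD('a) \<and> 2 \<le> c"
  shows "\<exists>Q :: 'a state set. mds_eaqecc \<gamma> N K (h + c + 1) c Q"
proof -
  obtain a :: "nat \<Rightarrow> 'a" and P where aP: "evaluation_points p e \<gamma> N a P" "degree P = c"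
    using exists_evaluation_points[OF points] by blast
  interpret evaluation_points field_type p e \<gamma> N a P
    by (rule aP(1))
  interpret css_code field_type p e \<gamma> N K h c affine_enc "h + c + 1"
    using css_code_affine aP assms by blast
  show ?thesis
    using eaqecc_encoded N by (auto simp: mds_eaqecc_def)
qed

text \<open>One coordinate sits at infinity, so only \<open>N - 1\<close> field elements are needed
  as points. A field with more than two elements contains the required
  \<open>\<beta>\<close>.\<close>

lemma exists_mds_extended:
  assumes N: "N = K + (h + (h + c))" and "K \<ge> 1" and c: "c = Suc j" and card: "CARD('a) > 2"
    and points: "N - 1 \<le> CARD('a) - 1 \<or> N - 1 \<le> CARD('a) \<and> 2 \<le> j"
  shows "\<exists>Q :: 'a state set. mds_eaqecc \<gamma> N K (h + c + 1) c Q"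
proof -
  obtain a :: "nat \<Rightarrow> 'a" and P where aP: "evaluation_points p e \<gamma> (N - 1) a P" "degree P = j"
    using exists_evaluation_points[OF points] by blast
  interpret evaluation_points field_type p e \<gamma> "N - 1" a P
    by (rule aP(1))
  have "card {0, 1 :: 'a} < CARD('a)"
    using card by simp
  then have "{0, 1} \<noteq> (UNIV :: 'a set)"
    by (metis less_irrefl)
  then obtain \<beta> :: 'a where \<beta>: "\<beta> \<noteq> 0" "\<beta> \<noteq> 1"
    by blast
  have "css_code p e \<gamma> (Suc (N - 1)) K h c (extended_enc \<beta>) (h + c + 1)"
    using \<beta> aP assms by (intro css_code_extended[of j]) simp_all
  then interpret css_code field_type p e \<gamma> N K h c "extended_enc \<beta>" "h + c + 1"
    using N c by simp
  show ?thesis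
    using eaqecc_encoded N by (auto simp: mds_eaqecc_def)
qed

end

theorem theorem8:
  fixes p e q l m y m1 n r k :: nat and \<gamma> :: complex
  assumes "prime p" and "odd p" and "e \<ge> 1" and "q = p ^ e"
    and "CARD('a::finite_field) = q"
    and "primitive_root_of_unity p \<gamma>"
    and "0 \<le> l" and "l \<le> e - 1" and "2 * l dvd e"
    and "m > 0" and "m dvd (q - 1)"
    and "y = (q - 1) div (p ^ l - 1)"
    and "m1 = m div gcd m y"
    and "n = r * m"
    and "1 \<le> r" and "r \<le> (p ^ l - 1) div m1"
    and "1 \<le> k" and "k \<le> (p ^ l + n) div (p ^ l + 1)"
  shows "(\<forall>h. h \<le> k - 1 \<longrightarrow>
            (\<exists>Q :: 'a state set. mds_eaqecc \<gamma> n (k - h) (n + 1 - k) (n - k - h) Q)) \<and>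
         (\<forall>h. h \<le> k \<longrightarrow>
            (\<exists>Q :: 'a state set. mds_eaqecc \<gamma> (n + 1) (k - h) (n + 2 - k) (n + 1 - k - h) Q)) \<and>
         (\<forall>h. h \<le> k - 1 \<longrightarrow>
            (\<exists>Q :: 'a state set. mds_eaqecc \<gamma> (n + 2) (k - h) (n + 3 - k) (n + 2 - k - h) Q))"
proof -
  interpret finite_field_character "TYPE('a)" p e \<gamma>
    using assms by unfold_locales auto
  have p3: "p \<ge> 3"
    using \<open>prime p\<close> \<open>odd p\<close> prime_ge_2_nat[of p] by (cases "p = 2") auto
  \<comment> \<open>For \<open>l = 0\<close> the hypothesis \<open>2 * l dvd e\<close> would force
    \<open>e = 0\<close>.\<close>
  have l0: "l \<noteq> 0"
    using assms by (intro notI) simp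
  have B3: "p ^ l \<ge> 3"
    using p3 l0 power_increasing[of 1 l p] by (simp add: order_trans)
  have "e \<ge> 2"
    using l0 assms by linarith
  then have "p ^ e \<ge> p ^ 2"
    using p3 by (intro power_increasing) auto
  moreover have "p ^ 2 \<ge> 3 ^ 2"
    using p3 by (intro power_mono) auto
  ultimately have q9: "q \<ge> 9"
    using \<open>q = p ^ e\<close> by simp
  \<comment> \<open>Write \<open>n\<close> as \<open>r * m1\<close> times \<open>gcd m y\<close>;
    the factors are at most \<open>p ^ l - 1\<close> and \<open>y\<close>.\<close>
  have n_le: "n \<le> q - 1"
  proof -
    have "m = m1 * gcd m y"
      using assms by simp
    then have "n = (r * m1) * gcd m y"
      using \<open>n = r * m\<close> by simp
    also have "r * m1 \<le> p ^ l - 1"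
      using \<open>r \<le> (p ^ l - 1) div m1\<close> by (metis div_times_less_eq_dividend mult_le_mono1 order_trans)
    then have "(r * m1) * gcd m y \<le> (p ^ l - 1) * gcd m y"
      by (rule mult_le_mono1)
    also have "gcd m y \<le> y"
    proof -
      have "p ^ l \<le> q"
        using assms p3 by (simp add: power_increasing)
      then have "p ^ l - 1 \<le> q - 1"
        by (rule diff_le_mono)
      then have "y > 0"
        using B3 unfolding \<open>y = _\<close> div_greater_zero_iff by simp
      then show ?thesis
        by (simp add: gcd_le2_nat)
    qed
    then have "(p ^ l - 1) * gcd m y \<le> (p ^ l - 1) * y"
      by (rule mult_le_mono2)
    also have "\<dots> \<le> q - 1"
      using \<open>y = _\<close> by simp
    finally show ?thesis .
  qed
  \<comment> \<open>The bound on \<open>k\<close> gives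
    \<open>(k - 1) * (p ^ l + 1) + 1 \<le> n\<close>, and \<open>p ^ l\<close> is at least
    \<open>3\<close>. This makes the truncated subtractions in the parameters exact.\<close>
  have n_ge: "n + 3 \<ge> 4 * k"
  proof -
    have "k * (p ^ l + 1) \<le> p ^ l + n"
      using \<open>k \<le> (p ^ l + n) div (p ^ l + 1)\<close>
      by (metis div_times_less_eq_dividend mult_le_mono1 order_trans)
    moreover obtain k' where k': "k = Suc k'"
      using \<open>1 \<le> k\<close> by (cases k) auto
    ultimately have "k' * p ^ l + k' + 1 \<le> n"
      by simp
    moreover have "k' * 3 \<le> k' * p ^ l"
      using B3 by (rule mult_le_mono2)
    ultimately have "k' * 3 + k' + 1 \<le> n"
      by (meson add_le_mono1 order_trans)
    then show ?thesis
      using k' by simp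
  qed
  \<comment> \<open>All field elements are used only if \<open>n = q - 1\<close>, so
    \<open>n\<close> is at least \<open>8\<close>; then \<open>n_ge\<close> leaves enough room for a
    \<open>P\<close> of degree at least \<open>2\<close>.\<close>
  have points: "n + 1 \<le> CARD('a) - 1 \<or> n + 1 \<le> CARD('a) \<and> 2 \<le> n + 1 - k - h" if "h \<le> k" for h
    using n_le n_ge q9 that \<open>CARD('a) = q\<close> by arith
  have "\<exists>Q :: 'a state set. mds_eaqecc \<gamma> n (k - h) (n + 1 - k) (n - k - h) Q" if "h \<le> k - 1" for h
  proof -
    have "n = (k - h) + (h + (h + (n - k - h)))" "(k - h) + h \<ge> 1" "n + 1 - k = h + (n - k - h) + 1"
      using that n_ge \<open>1 \<le> k\<close> by arith+
    then show ?thesis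
      using exists_mds_affine[of n "k - h" h "n - k - h"] n_le \<open>CARD('a) = q\<close> by simp
  qed
  moreover have "\<exists>Q :: 'a state set. mds_eaqecc \<gamma> (n + 1) (k - h) (n + 2 - k) (n + 1 - k - h) Q"
    if "h \<le> k" for h
  proof -
    have "n + 1 = (k - h) + (h + (h + (n + 1 - k - h)))" "(k - h) + h \<ge> 1"
      "n + 2 - k = h + (n + 1 - k - h) + 1"
      using that n_ge \<open>1 \<le> k\<close> by arith+
    then show ?thesis
      using exists_mds_affine[of "n + 1" "k - h" h "n + 1 - k - h"] points[OF that] by metis
  qed
  moreover have "\<exists>Q :: 'a state set. mds_eaqecc \<gamma> (n + 2) (k - h) (n + 3 - k) (n + 2 - k - h) Q"
    if "h \<le> k - 1" for h
  proof -
    \<comment> \<open>Here \<open>n + 1\<close> finite points are joined by infinity, and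
      \<open>P\<close> has degree one less than the number of entangled pairs.\<close>
    have "n + 2 = (k - h) + (h + (h + (n + 2 - k - h)))" "k - h \<ge> 1"
      "n + 2 - k - h = Suc (n + 1 - k - h)" "n + 3 - k = h + (n + 2 - k - h) + 1" "n + 2 - 1 = n + 1"
      using that n_ge \<open>1 \<le> k\<close> by arith+
    moreover have "h \<le> k" "CARD('a) > 2"
      using that q9 \<open>CARD('a) = q\<close> by auto
    ultimately show ?thesis
      using exists_mds_extended[of "n + 2" "k - h" h "n + 2 - k - h" "n + 1 - k - h"] points[of h] by metis
  qed
  ultimately show ?thesis
    by blast
qed

end
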